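(* Let $\mathcal U$ be a variety with a difference term and $(Q,B^{\tau})$ central datum in $\mathcal U$. Let $\pi:A\to Q$ be an extension in $\mathcal U$ realizing $(Q,B^\tau)$ and represented by $[T]\in H^{2}_{\mathcal U}(Q,B^{\tau})$, and let $\delta_T:\mathrm{Hom}(B^{\tau},E^{\tau})\to H^{2}_{\mathcal U}(Q,E^{\tau})$ be the associated transgression for a regular kernel algebra $E^{\tau}\in\mathcal U$. (1) If $\ker\pi\le[1_A,1_A]$, then the transgression $\delta_T$ is injective. (2) If $A$ has an idempotent element and $\delta_T$ is injective, then $\ker\pi\le[1_A,1_A]$.
   Context: Conventions. Algebras are universal algebras in a signature $\tau$; $[\alpha,\beta]$ is the term-condition commutator of congruences; $0_A,1_A$ are the least and greatest congruences of $A$. A variety $\mathcal U$ has a difference term if there is a ternary term $m$ with $m(x,x,y)=y$ in $\mathcal U$ and $(x,m(x,y,y))\in[\alpha,\alpha]$ whenever $A\in\mathcal U$ and $(x,y)\in\alpha\in\mathrm{Con}\,A$; it is assumed throughout that $m$ is a fundamental operation symbol of $\tau$. An extension is a surjective homomorphism; it is central if its kernel $\alpha$ satisfies $[\alpha,1]=0$. An element $u$ is idempotent if $f(u,\ldots,u)=u$ for all $f\in\tau$. Kernel algebras and datum. A kernel algebra $B^{\tau}$ is a $\tau$-algebra on the universe of a unital module $B$ over a ring $R$ with $1$ in which each $f\in\tau$ is a module term $f^{B}(x_1,\ldots,x_n)=r_1x_1+\cdots+r_nx_n$ $(r_i\in R)$ and $m^{B}(x,y,z)=x-y+z$. Central datum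 $(Q,B^{\tau})$ in $\mathcal U$ is a kernel algebra $B^{\tau}\in\mathcal U$ and an algebra $Q\in\mathcal U$. A kernel algebra $E^{\tau}\in\mathcal U$ is regular in $\mathcal U$ if (RD1) for kernel algebras $B^{\tau}\le C^{\tau}$ in $\mathcal U$ every homomorphism $B^{\tau}\to E^{\tau}$ extends to a homomorphism $C^{\tau}\to E^{\tau}$; (RD2) for every kernel algebra $B^{\tau}\in\mathcal U$, $\alpha\in\mathrm{Con}\,B^{\tau}$ and $(a,b)\notin\alpha$ there is a homomorphism $\phi:B^{\tau}\to E^{\tau}$ with $\alpha\le\ker\phi$, $(a,b)\notin\ker\phi$. $\mathrm{Hom}(B^{\tau},E^{\tau})$, for kernel algebras, is the abelian group of $\tau$-homomorphisms preserving $0$. Cocycles. A 2-cocycle for $(Q,B^{\tau})$ is a family $T=\{T_f:Q^{\mathrm{ar} f}\to B\}_{f\in\tau}$. The algebra $B^{\tau}\otimes^{T}Q$ has universe $B\times Q$ and operations $F_f((b_1,q_1),\ldots,(b_n,q_n))=(f^{B}(\vec b)+T_f(\vec q),f^{Q}(\vec q))$; $p_2$ is its second projection to $Q$. For a term $t$ define $t^{\partial,T}$ by $x^{\partial,T}=0$ for a variable and $f(t_1,\ldots,t_n)^{\partial,T}=f^{B}(t_1^{\partial,T},\ldots,t_n^{\partial,T})+T_f(t_1^{Q},\ldots,t_n^{Q})$. $T$ is $\mathcal U$-compatible if $t^{\partial,T}=g^{\partial,T}$ under all evaluations in $Q$ for every identity $t=g$ of $\mathcal U$. A 2-coboundary is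 a family $G_f(\vec x)=f^{B}(h(\vec x))-h(f^{Q}(\vec x))$ for some function $h:Q\to B$. Under pointwise addition, $H^{2}_{\mathcal U}(Q,B^{\tau})$ is the group of $\mathcal U$-compatible 2-cocycles modulo 2-coboundaries. A (central) extension $\pi:A\to Q$, $A\in\mathcal U$, realizes $(Q,B^{\tau})$ and is represented by $[T]$ if there is an isomorphism $\psi:A\to B^{\tau}\otimes^{T}Q$ with $p_2\circ\psi=\pi$, $T$ being $\mathcal U$-compatible. Transgression: $\delta_T(\phi)=[\phi\circ T]$. *)

theory Defs
  imports "HOL-Algebra.Module" "HOL-Algebra.Coset"
begin

section \<open>Universal algebras\<close>

text \<open>A signature is a type \<open>'f\<close> of operation symbols together with an arity function
  \<open>ar :: 'f \<Rightarrow> nat\<close>. Operations take argument lists; their values are only relevant on lists over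
  the carrier of the right length.\<close>

datatype ('f, 'v) trm = Var 'v | Op 'f "('f, 'v) trm list"

fun wf_trm :: "('f \<Rightarrow> nat) \<Rightarrow> ('f, 'v) trm \<Rightarrow> bool" where
  "wf_trm ar (Var x) = True"
| "wf_trm ar (Op f ts) = (length ts = ar f \<and> (\<forall>t\<in>set ts. wf_trm ar t))"

record ('a, 'f) ualgebra = "'a partial_object" +
  oper :: "'f \<Rightarrow> 'a list \<Rightarrow> 'a"

definition args :: "'a set \<Rightarrow> nat \<Rightarrow> 'a list set" where
  "args X n = {xs. length xs = n \<and> set xs \<subseteq> X}"

definition is_ualgebra :: "('f \<Rightarrow> nat) \<Rightarrow> ('a, 'f) ualgebra \<Rightarrow> bool" where
  "is_ualgebra ar A \<longleftrightarrow>
     carrier A \<noteq> {} \<and> (\<forall>f. \<forall>xs\<in>args (carrier A) (ar f). oper A f xs \<in> carrier A)"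

fun eval :: "('a, 'f) ualgebra \<Rightarrow> ('v \<Rightarrow> 'a) \<Rightarrow> ('f, 'v) trm \<Rightarrow> 'a" where
  "eval A \<rho> (Var x) = \<rho> x"
| "eval A \<rho> (Op f ts) = oper A f (map (eval A \<rho>) ts)"

definition satisfies ::
  "('a, 'f) ualgebra \<Rightarrow> ('f, nat) trm \<Rightarrow> ('f, nat) trm \<Rightarrow> bool" where
  "satisfies A s t \<longleftrightarrow> (\<forall>\<rho>. range \<rho> \<subseteq> carrier A \<longrightarrow> eval A \<rho> s = eval A \<rho> t)"

definition is_hom ::
  "('f \<Rightarrow> nat) \<Rightarrow> ('a, 'f) ualgebra \<Rightarrow> ('b, 'f) ualgebra \<Rightarrow> ('a \<Rightarrow> 'b) \<Rightarrow> bool" where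
  "is_hom ar A B \<phi> \<longleftrightarrow> \<phi> \<in> carrier A \<rightarrow> carrier B \<and>
     (\<forall>f. \<forall>xs\<in>args (carrier A) (ar f). \<phi> (oper A f xs) = oper B f (map \<phi> xs))"

definition is_iso ::
  "('f \<Rightarrow> nat) \<Rightarrow> ('a, 'f) ualgebra \<Rightarrow> ('b, 'f) ualgebra \<Rightarrow> ('a \<Rightarrow> 'b) \<Rightarrow> bool" where
  "is_iso ar A B \<phi> \<longleftrightarrow> is_hom ar A B \<phi> \<and> bij_betw \<phi> (carrier A) (carrier B)"

definition subalgebra ::
  "('f \<Rightarrow> nat) \<Rightarrow> ('a, 'f) ualgebra \<Rightarrow> ('a, 'f) ualgebra \<Rightarrow> bool" where
  "subalgebra ar A B \<longleftrightarrow> carrier A \<subseteq> carrier B \<and>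
     (\<forall>f. \<forall>xs\<in>args (carrier A) (ar f). oper A f xs = oper B f xs)"

definition idempotent_element :: "('f \<Rightarrow> nat) \<Rightarrow> ('a, 'f) ualgebra \<Rightarrow> 'a \<Rightarrow> bool" where
  "idempotent_element ar A u \<longleftrightarrow>
     u \<in> carrier A \<and> (\<forall>f. oper A f (replicate (ar f) u) = u)"


section \<open>Congruences and the term-condition commutator\<close>

definition Con :: "('f \<Rightarrow> nat) \<Rightarrow> ('a, 'f) ualgebra \<Rightarrow> ('a \<times> 'a) set set" where
  "Con ar A = {\<theta>. equiv (carrier A) \<theta> \<and>
     (\<forall>f. \<forall>xs\<in>args (carrier A) (ar f). \<forall>ys\<in>args (carrier A) (ar f).
        (\<forall>i<ar f. (xs ! i, ys ! i) \<in> \<theta>) \<longrightarrow> (oper A f xs, oper A f ys) \<in> \<theta>)}"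

definition con_top :: "('a, 'f) ualgebra \<Rightarrow> ('a \<times> 'a) set" where
  "con_top A = carrier A \<times> carrier A"

definition ker_of :: "('a, 'f) ualgebra \<Rightarrow> ('a \<Rightarrow> 'b) \<Rightarrow> ('a \<times> 'a) set" where
  "ker_of A \<phi> = {(x, y). x \<in> carrier A \<and> y \<in> carrier A \<and> \<phi> x = \<phi> y}"

text \<open>The term condition \<open>C(\<alpha>, \<beta>; \<delta>)\<close>. The variables of the term are split into two
  blocks by the sum type; only finitely many variables of each block occur in a term.\<close>

definition centralizes ::
  "('f \<Rightarrow> nat) \<Rightarrow> ('a, 'f) ualgebra \<Rightarrow> ('a \<times> 'a) set \<Rightarrow> ('a \<times> 'a) set \<Rightarrow> ('a \<times> 'a) set \<Rightarrow> bool"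
where
  "centralizes ar A \<alpha> \<beta> \<delta> \<longleftrightarrow>
     (\<forall>t :: ('f, nat + nat) trm. \<forall>a b u v. wf_trm ar t \<longrightarrow>
        (\<forall>i. (a i, b i) \<in> \<alpha>) \<longrightarrow> (\<forall>j. (u j, v j) \<in> \<beta>) \<longrightarrow>
        (eval A (case_sum a u) t, eval A (case_sum a v) t) \<in> \<delta> \<longrightarrow>
        (eval A (case_sum b u) t, eval A (case_sum b v) t) \<in> \<delta>)"

definition commutator ::
  "('f \<Rightarrow> nat) \<Rightarrow> ('a, 'f) ualgebra \<Rightarrow> ('a \<times> 'a) set \<Rightarrow> ('a \<times> 'a) set \<Rightarrow> ('a \<times> 'a) set"
where
  "commutator ar A \<alpha> \<beta> = \<Inter> {\<delta> \<in> Con ar A. centralizes ar A \<alpha> \<beta> \<delta>}"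


section \<open>Varieties\<close>

text \<open>A variety is given by a set \<open>\<U>\<close> of defining identities (Birkhoff). The type of \<open>\<U>\<close>
  does not mention universes, so \<open>\<U>\<close> has members on every type.\<close>

type_synonym 'f eqns = "(('f, nat) trm \<times> ('f, nat) trm) set"

definition is_variety :: "('f \<Rightarrow> nat) \<Rightarrow> 'f eqns \<Rightarrow> bool" where
  "is_variety ar \<U> \<longleftrightarrow> (\<forall>(s, t)\<in>\<U>. wf_trm ar s \<and> wf_trm ar t)"

definition in_variety :: "('f \<Rightarrow> nat) \<Rightarrow> 'f eqns \<Rightarrow> ('a, 'f) ualgebra \<Rightarrow> bool" where
  "in_variety ar \<U> A \<longleftrightarrow> is_ualgebra ar A \<and> (\<forall>(s, t)\<in>\<U>. satisfies A s t)"

text \<open>All identities of the variety. It suffices to test members whose universe lies in the type of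
  terms: the free algebra of countable rank is a quotient of the term algebra, so by choosing
  representatives it has an isomorphic copy on that type.\<close>

definition identities :: "('f \<Rightarrow> nat) \<Rightarrow> 'f eqns \<Rightarrow> 'f eqns" where
  "identities ar \<U> = {(s, t). wf_trm ar s \<and> wf_trm ar t \<and>
     (\<forall>A :: (('f, nat) trm, 'f) ualgebra. in_variety ar \<U> A \<longrightarrow> satisfies A s t)}"

text \<open>The type \<open>'u\<close> is the ambient set-theoretic universe: the congruence condition is imposed
  on the members of the variety whose carrier is a subset of \<open>'u\<close>. This is implied by the
  condition for all members whatsoever, and it is equivalent to it as soon as the terms inject
  into \<open>'u\<close>, because a failure passes to a quotient of a two-generated subalgebra.\<close>

definition difference_term :: "'u itself \<Rightarrow> ('f \<Rightarrow> nat) \<Rightarrow> 'f eqns \<Rightarrow> 'f \<Rightarrow> bool" where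
  "difference_term U ar \<U> m \<longleftrightarrow> ar m = 3 \<and>
     (Op m [Var 0, Var 0, Var 1], Var 1) \<in> identities ar \<U> \<and>
     (\<forall>A :: ('u, 'f) ualgebra. in_variety ar \<U> A \<longrightarrow>
        (\<forall>\<alpha>\<in>Con ar A. \<forall>(x, y)\<in>\<alpha>. (x, oper A m [x, y, y]) \<in> commutator ar A \<alpha> \<alpha>))"


section \<open>Kernel algebras\<close>

text \<open>The library's modules are over commutative rings, hence the following variant.\<close>

locale unital_left_module = R?: ring R + M?: abelian_group M
  for R :: "('r, 'x) ring_scheme" (structure) and M :: "('r, 'a, 'y) module_scheme" (structure) +
  assumes smult_closed:
      "\<lbrakk>r \<in> carrier R; x \<in> carrier M\<rbrakk> \<Longrightarrow> r \<odot>\<^bsub>M\<^esub> x \<in> carrier M"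
    and smult_l_distr:
      "\<lbrakk>r \<in> carrier R; s \<in> carrier R; x \<in> carrier M\<rbrakk> \<Longrightarrow>
       (r \<oplus> s) \<odot>\<^bsub>M\<^esub> x = r \<odot>\<^bsub>M\<^esub> x \<oplus>\<^bsub>M\<^esub> s \<odot>\<^bsub>M\<^esub> x"
    and smult_r_distr:
      "\<lbrakk>r \<in> carrier R; x \<in> carrier M; y \<in> carrier M\<rbrakk> \<Longrightarrow>
       r \<odot>\<^bsub>M\<^esub> (x \<oplus>\<^bsub>M\<^esub> y) = r \<odot>\<^bsub>M\<^esub> x \<oplus>\<^bsub>M\<^esub> r \<odot>\<^bsub>M\<^esub> y"
    and smult_assoc:
      "\<lbrakk>r \<in> carrier R; s \<in> carrier R; x \<in> carrier M\<rbrakk> \<Longrightarrow>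
       (r \<otimes> s) \<odot>\<^bsub>M\<^esub> x = r \<odot>\<^bsub>M\<^esub> (s \<odot>\<^bsub>M\<^esub> x)"
    and smult_one:
      "x \<in> carrier M \<Longrightarrow> \<one> \<odot>\<^bsub>M\<^esub> x = x"

text \<open>A record \<open>B\<close> of the following type carries both the module \<open>B\<close> and the operations of
  \<open>B\<^sup>\<tau>\<close>; the algebra \<open>B\<^sup>\<tau>\<close> itself is \<open>alg B\<close>. As for the library's modules, the
  inherited fields \<open>mult\<close> and \<open>one\<close> are not used.\<close>

record ('r, 'a, 'f) kernel_algebra = "('r, 'a) module" +
  kop :: "'f \<Rightarrow> 'a list \<Rightarrow> 'a"

definition alg :: "('r, 'a, 'f) kernel_algebra \<Rightarrow> ('a, 'f) ualgebra" where
  "alg B = \<lparr>carrier = carrier B, oper = kop B\<rparr>"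

definition is_kernel_algebra ::
  "('f \<Rightarrow> nat) \<Rightarrow> 'f \<Rightarrow> 'r ring \<Rightarrow> ('r, 'a, 'f) kernel_algebra \<Rightarrow> bool" where
  "is_kernel_algebra ar m R B \<longleftrightarrow> unital_left_module R B \<and>
     (\<forall>f. \<exists>r \<in> {..<ar f} \<rightarrow> carrier R. \<forall>xs\<in>args (carrier B) (ar f).
        kop B f xs = (\<Oplus>\<^bsub>B\<^esub>i\<in>{..<ar f}. r i \<odot>\<^bsub>B\<^esub> xs ! i)) \<and>
     (\<forall>x\<in>carrier B. \<forall>y\<in>carrier B. \<forall>z\<in>carrier B.
        kop B m [x, y, z] = (x \<ominus>\<^bsub>B\<^esub> y) \<oplus>\<^bsub>B\<^esub> z)"

definition central_datum ::
  "('f \<Rightarrow> nat) \<Rightarrow> 'f eqns \<Rightarrow> 'f \<Rightarrow> ('q, 'f) ualgebra \<Rightarrow> 'r ring \<Rightarrow>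
   ('r, 'a, 'f) kernel_algebra \<Rightarrow> bool" where
  "central_datum ar \<U> m Q R B \<longleftrightarrow> in_variety ar \<U> Q \<and>
     is_kernel_algebra ar m R B \<and> in_variety ar \<U> (alg B)"

text \<open>In the two conditions below, test algebras range over kernel algebras with carrier in the
  universe \<open>'u\<close> over rings in \<open>'u \<Rightarrow> 'u\<close>. The latter is no restriction: a kernel algebra
  over any ring is one over the ring of additive endomorphisms of its underlying group. In the first
  condition neither the rings nor the zeros of the two algebras are required to agree.\<close>

definition RD1 ::
  "('f \<Rightarrow> nat) \<Rightarrow> 'f eqns \<Rightarrow> 'f \<Rightarrow> ('s, 'u, 'f) kernel_algebra \<Rightarrow> bool" where
  "RD1 ar \<U> m E \<longleftrightarrow>
     (\<forall>(R :: ('u \<Rightarrow> 'u) ring) (R' :: ('u \<Rightarrow> 'u) ring)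
       (B :: ('u \<Rightarrow> 'u, 'u, 'f) kernel_algebra) (C :: ('u \<Rightarrow> 'u, 'u, 'f) kernel_algebra).
        is_kernel_algebra ar m R B \<longrightarrow> in_variety ar \<U> (alg B) \<longrightarrow>
        is_kernel_algebra ar m R' C \<longrightarrow> in_variety ar \<U> (alg C) \<longrightarrow>
        subalgebra ar (alg B) (alg C) \<longrightarrow>
        (\<forall>\<phi>. is_hom ar (alg B) (alg E) \<phi> \<longrightarrow>
           (\<exists>\<chi>. is_hom ar (alg C) (alg E) \<chi> \<and> (\<forall>x\<in>carrier B. \<chi> x = \<phi> x))))"

definition RD2 ::
  "('f \<Rightarrow> nat) \<Rightarrow> 'f eqns \<Rightarrow> 'f \<Rightarrow> ('s, 'u, 'f) kernel_algebra \<Rightarrow> bool" where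
  "RD2 ar \<U> m E \<longleftrightarrow>
     (\<forall>(R :: ('u \<Rightarrow> 'u) ring) (B :: ('u \<Rightarrow> 'u, 'u, 'f) kernel_algebra).
        is_kernel_algebra ar m R B \<longrightarrow> in_variety ar \<U> (alg B) \<longrightarrow>
        (\<forall>\<alpha>\<in>Con ar (alg B). \<forall>a\<in>carrier B. \<forall>b\<in>carrier B. (a, b) \<notin> \<alpha> \<longrightarrow>
           (\<exists>\<phi>. is_hom ar (alg B) (alg E) \<phi> \<and> \<alpha> \<subseteq> ker_of (alg B) \<phi> \<and>
                (a, b) \<notin> ker_of (alg B) \<phi>)))"

definition regular_kernel_algebra ::
  "('f \<Rightarrow> nat) \<Rightarrow> 'f eqns \<Rightarrow> 'f \<Rightarrow> 's ring \<Rightarrow> ('s, 'u, 'f) kernel_algebra \<Rightarrow> bool" where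
  "regular_kernel_algebra ar \<U> m S E \<longleftrightarrow>
     is_kernel_algebra ar m S E \<and> in_variety ar \<U> (alg E) \<and> RD1 ar \<U> m E \<and> RD2 ar \<U> m E"

text \<open>Elements are extensional functions, so that equality of homomorphisms is equality on
  the carrier.\<close>

definition Hom ::
  "('f \<Rightarrow> nat) \<Rightarrow> ('r, 'a, 'f) kernel_algebra \<Rightarrow> ('s, 'b, 'f) kernel_algebra \<Rightarrow> ('a \<Rightarrow> 'b) monoid"
where
  "Hom ar B E =
     \<lparr>carrier = {\<phi> \<in> carrier B \<rightarrow>\<^sub>E carrier E.
                  is_hom ar (alg B) (alg E) \<phi> \<and> \<phi> \<zero>\<^bsub>B\<^esub> = \<zero>\<^bsub>E\<^esub>},
      mult = (\<lambda>\<phi> \<psi>. \<lambda>x\<in>carrier B. \<phi> x \<oplus>\<^bsub>E\<^esub> \<psi> x),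
      one = (\<lambda>x\<in>carrier B. \<zero>\<^bsub>E\<^esub>)\<rparr>"


section \<open>Cocycles and second cohomology\<close>

type_synonym ('q, 'a, 'f) cochain = "'f \<Rightarrow> 'q list \<Rightarrow> 'a"

definition two_cocycles ::
  "('f \<Rightarrow> nat) \<Rightarrow> ('q, 'f) ualgebra \<Rightarrow> ('r, 'a, 'f) kernel_algebra \<Rightarrow> ('q, 'a, 'f) cochain set"
where
  "two_cocycles ar Q B = {T. \<forall>f. T f \<in> args (carrier Q) (ar f) \<rightarrow>\<^sub>E carrier B}"

definition tensor_alg ::
  "('r, 'a, 'f) kernel_algebra \<Rightarrow> ('q, 'a, 'f) cochain \<Rightarrow> ('q, 'f) ualgebra \<Rightarrow>
   ('a \<times> 'q, 'f) ualgebra" where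
  "tensor_alg B T Q =
     \<lparr>carrier = carrier B \<times> carrier Q,
      oper = (\<lambda>f ps. (kop B f (map fst ps) \<oplus>\<^bsub>B\<^esub> T f (map snd ps), oper Q f (map snd ps)))\<rparr>"

text \<open>The value of \<open>t\<^sup>\<partial>\<^sup>,\<^sup>T\<close> at an assignment in \<open>Q\<close>.\<close>

fun trm_bd ::
  "('q, 'f) ualgebra \<Rightarrow> ('r, 'a, 'f) kernel_algebra \<Rightarrow> ('q, 'a, 'f) cochain \<Rightarrow>
   (nat \<Rightarrow> 'q) \<Rightarrow> ('f, nat) trm \<Rightarrow> 'a" where
  "trm_bd Q B T \<rho> (Var x) = \<zero>\<^bsub>B\<^esub>"
| "trm_bd Q B T \<rho> (Op f ts) =
     kop B f (map (trm_bd Q B T \<rho>) ts) \<oplus>\<^bsub>B\<^esub> T f (map (eval Q \<rho>) ts)"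

definition compatible ::
  "('f \<Rightarrow> nat) \<Rightarrow> 'f eqns \<Rightarrow> ('q, 'f) ualgebra \<Rightarrow> ('r, 'a, 'f) kernel_algebra \<Rightarrow>
   ('q, 'a, 'f) cochain \<Rightarrow> bool" where
  "compatible ar \<U> Q B T \<longleftrightarrow>
     (\<forall>(s, t)\<in>identities ar \<U>. \<forall>\<rho>. range \<rho> \<subseteq> carrier Q \<longrightarrow>
        trm_bd Q B T \<rho> s = trm_bd Q B T \<rho> t)"

definition Z2 ::
  "('f \<Rightarrow> nat) \<Rightarrow> 'f eqns \<Rightarrow> ('q, 'f) ualgebra \<Rightarrow> ('r, 'a, 'f) kernel_algebra \<Rightarrow>
   ('q, 'a, 'f) cochain monoid" where
  "Z2 ar \<U> Q B =
     \<lparr>carrier = {T \<in> two_cocycles ar Q B. compatible ar \<U> Q B T},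
      mult = (\<lambda>S T f. \<lambda>xs\<in>args (carrier Q) (ar f). S f xs \<oplus>\<^bsub>B\<^esub> T f xs),
      one = (\<lambda>f. \<lambda>xs\<in>args (carrier Q) (ar f). \<zero>\<^bsub>B\<^esub>)\<rparr>"

definition two_coboundaries ::
  "('f \<Rightarrow> nat) \<Rightarrow> ('q, 'f) ualgebra \<Rightarrow> ('r, 'a, 'f) kernel_algebra \<Rightarrow> ('q, 'a, 'f) cochain set"
where
  "two_coboundaries ar Q B =
     {(\<lambda>f. \<lambda>xs\<in>args (carrier Q) (ar f). kop B f (map h xs) \<ominus>\<^bsub>B\<^esub> h (oper Q f xs)) | h.
        h \<in> carrier Q \<rightarrow> carrier B}"

definition H2 ::
  "('f \<Rightarrow> nat) \<Rightarrow> 'f eqns \<Rightarrow> ('q, 'f) ualgebra \<Rightarrow> ('r, 'a, 'f) kernel_algebra \<Rightarrow>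
   ('q, 'a, 'f) cochain set monoid" where
  "H2 ar \<U> Q B = Z2 ar \<U> Q B Mod two_coboundaries ar Q B"

definition H2_class ::
  "('f \<Rightarrow> nat) \<Rightarrow> 'f eqns \<Rightarrow> ('q, 'f) ualgebra \<Rightarrow> ('r, 'a, 'f) kernel_algebra \<Rightarrow>
   ('q, 'a, 'f) cochain \<Rightarrow> ('q, 'a, 'f) cochain set" where
  "H2_class ar \<U> Q B T = two_coboundaries ar Q B #>\<^bsub>Z2 ar \<U> Q B\<^esub> T"

definition is_extension ::
  "('f \<Rightarrow> nat) \<Rightarrow> ('a, 'f) ualgebra \<Rightarrow> ('q, 'f) ualgebra \<Rightarrow> ('a \<Rightarrow> 'q) \<Rightarrow> bool" where
  "is_extension ar A Q p \<longleftrightarrow> is_hom ar A Q p \<and> p ` carrier A = carrier Q"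

text \<open>The extension \<open>p : A \<rightarrow> Q\<close> realizes the datum and is represented by the class of \<open>T\<close>.\<close>

definition represented_by ::
  "('f \<Rightarrow> nat) \<Rightarrow> 'f eqns \<Rightarrow> ('q, 'f) ualgebra \<Rightarrow> ('r, 'b, 'f) kernel_algebra \<Rightarrow>
   ('a, 'f) ualgebra \<Rightarrow> ('a \<Rightarrow> 'q) \<Rightarrow> ('q, 'b, 'f) cochain \<Rightarrow> bool" where
  "represented_by ar \<U> Q B A p T \<longleftrightarrow> T \<in> carrier (Z2 ar \<U> Q B) \<and>
     (\<exists>\<psi>. is_iso ar A (tensor_alg B T Q) \<psi> \<and> (\<forall>x\<in>carrier A. snd (\<psi> x) = p x))"

definition transgression ::
  "('f \<Rightarrow> nat) \<Rightarrow> 'f eqns \<Rightarrow> ('q, 'f) ualgebra \<Rightarrow> ('s, 'b, 'f) kernel_algebra \<Rightarrow>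
   ('q, 'a, 'f) cochain \<Rightarrow> ('a \<Rightarrow> 'b) \<Rightarrow> ('q, 'b, 'f) cochain set" where
  "transgression ar \<U> Q E T \<phi> =
     H2_class ar \<U> Q E (\<lambda>f. \<lambda>xs\<in>args (carrier Q) (ar f). \<phi> (T f xs))"

end

theory Submission
  imports Defs
begin

text \<open>If \<open>\<phi> \<circ> T\<close> and \<open>\<chi> \<circ> T\<close> differ by the coboundary of \<open>h\<close>, then
  \<open>(b, q) \<mapsto> \<phi> b - \<chi> b + h q\<close> is a homomorphism from the extension to \<open>E\<close>. As \<open>E\<close> is affine,
  its kernel contains \<open>[1, 1]\<close>; if \<open>[1, 1]\<close> contains \<open>ker \<pi>\<close>, the homomorphism is constant on the fibres
  of \<open>\<pi>\<close> and \<open>\<phi> = \<chi>\<close>. Conversely, a pair in \<open>ker \<pi>\<close> outside \<open>[1, 1]\<close> has different images in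
  \<open>A / [1, 1]\<close>. The difference term and the term condition make this quotient affine, and with the
  class of the idempotent element as zero it is a kernel algebra, so by (RD2) the pair is separated
  by some homomorphism \<open>g : A \<rightarrow> E\<close>. Up to translation, the restriction of \<open>g\<close> to the fibre of the
  idempotent element is a nonzero homomorphism \<open>\<theta> : B \<rightarrow> E\<close> with \<open>\<theta> \<circ> T\<close> a coboundary.\<close>

section \<open>Homomorphisms and evaluation\<close>

lemma args_map:
  "xs \<in> args X n \<Longrightarrow> (\<And>x. x \<in> X \<Longrightarrow> g x \<in> Y) \<Longrightarrow> map g xs \<in> args Y n"
  by (auto simp: args_def)

lemma args_mono: "xs \<in> args X n \<Longrightarrow> X \<subseteq> Y \<Longrightarrow> xs \<in> args Y n"
  by (auto simp: args_def)

lemma is_homD: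
  assumes "is_hom ar A B \<phi>"
  shows "x \<in> carrier A \<Longrightarrow> \<phi> x \<in> carrier B"
    and "xs \<in> args (carrier A) (ar f) \<Longrightarrow> \<phi> (oper A f xs) = oper B f (map \<phi> xs)"
  using assms by (auto simp: is_hom_def)

lemma is_hom_compose:
  assumes "is_hom ar A B \<phi>" and "is_hom ar B C \<chi>"
  shows "is_hom ar A C (\<chi> \<circ> \<phi>)"
  unfolding is_hom_def
proof (intro conjI allI ballI)
  show "\<chi> \<circ> \<phi> \<in> carrier A \<rightarrow> carrier C"
    using assms by (auto simp: is_hom_def)
next
  fix f xs
  assume xs: "xs \<in> args (carrier A) (ar f)"
  then have "map \<phi> xs \<in> args (carrier B) (ar f)"
    by (rule args_map) (rule is_homD(1)[OF assms(1)])
  then show "(\<chi> \<circ> \<phi>) (oper A f xs) = oper C f (map (\<chi> \<circ> \<phi>) xs)"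
    using is_homD(2)[OF assms(1) xs] is_homD(2)[OF assms(2)] by simp
qed

text \<open>Carries homomorphisms defined on \<open>A\<close> over to
  \<open>tensor_alg B T Q\<close>, where they can be computed in coordinates.\<close>

lemma is_iso_inverse:
  assumes A: "is_ualgebra ar A" and iso: "is_iso ar A B \<phi>"
  shows "is_hom ar B A (inv_into (carrier A) \<phi>)"
proof -
  let ?inv = "inv_into (carrier A) \<phi>"
  have hom: "is_hom ar A B \<phi>" and bij: "bij_betw \<phi> (carrier A) (carrier B)"
    using iso by (auto simp: is_iso_def)
  have closed: "?inv y \<in> carrier A" and right: "\<phi> (?inv y) = y" if "y \<in> carrier B" for y
    using bij that by (auto simp: bij_betw_def inv_into_into f_inv_into_f)
  have "?inv (oper B f ys) = oper A f (map ?inv ys)" if ys: "ys \<in> args (carrier B) (ar f)" for f ys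
  proof -
    have xs: "map ?inv ys \<in> args (carrier A) (ar f)"
      using ys closed by (rule args_map)
    have "map \<phi> (map ?inv ys) = ys"
      using ys right by (auto simp: args_def intro!: map_idI)
    then have "\<phi> (oper A f (map ?inv ys)) = oper B f ys"
      using is_homD(2)[OF hom xs] by simp
    then show ?thesis
      using A xs bij by (metis bij_betw_def inv_into_f_f is_ualgebra_def)
  qed
  then show ?thesis
    using closed by (auto simp: is_hom_def)
qed

section \<open>Term values and the transfer of identities along homomorphisms\<close>

lemma eval_closed:
  assumes "is_ualgebra ar A" and "wf_trm ar t" and "range \<sigma> \<subseteq> carrier A"
  shows "eval A \<sigma> t \<in> carrier A"
  using assms(2)
proof (induction t)
  case (Op f ts)
  then have "map (eval A \<sigma>) ts \<in> args (carrier A) (ar f)"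
    by (auto simp: args_def)
  then show ?case
    using assms(1) by (simp add: is_ualgebra_def)
qed (use assms(3) in auto)

lemma eval_hom:
  assumes A: "is_ualgebra ar A" and hom: "is_hom ar A B \<phi>"
    and wf: "wf_trm ar t" and \<sigma>: "range \<sigma> \<subseteq> carrier A"
  shows "\<phi> (eval A \<sigma> t) = eval B (\<phi> \<circ> \<sigma>) t"
  using wf
proof (induction t)
  case (Op f ts)
  then have "map (eval A \<sigma>) ts \<in> args (carrier A) (ar f)"
    using eval_closed[OF A _ \<sigma>] by (auto simp: args_def)
  then have "\<phi> (oper A f (map (eval A \<sigma>) ts)) = oper B f (map \<phi> (map (eval A \<sigma>) ts))"
    by (rule is_homD(2)[OF hom])
  moreover have "map \<phi> (map (eval A \<sigma>) ts) = map (eval B (\<phi> \<circ> \<sigma>)) ts"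
    using Op by (simp del: comp_apply) (simp add: o_def)
  ultimately show ?case
    by (simp only: eval.simps)
qed simp

text \<open>An assignment in \<open>C\<close> lifts to \<open>A\<close> along a section of
  \<open>\<phi>\<close>, so both sides of an identity are images of equal values. Closure of
  \<open>C\<close> under its operations follows from surjectivity in the same way.\<close>

lemma in_variety_image:
  assumes var: "is_variety ar \<U>" and A: "in_variety ar \<U> A"
    and hom: "is_hom ar A (C :: ('c, 'f) ualgebra) \<phi>" and surj: "\<phi> ` carrier A = carrier C"
  shows "in_variety ar \<U> C"
proof -
  let ?inv = "inv_into (carrier A) \<phi>"
  have ua: "is_ualgebra ar A"
    using A by (simp add: in_variety_def)
  have inv: "?inv y \<in> carrier A" "\<phi> (?inv y) = y" if "y \<in> carrier C" for y
    using that surj by (auto simp: inv_into_into f_inv_into_f)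
  have "oper C f ys \<in> carrier C" if ys: "ys \<in> args (carrier C) (ar f)" for f ys
  proof -
    have xs: "map ?inv ys \<in> args (carrier A) (ar f)"
      using ys inv(1) by (rule args_map)
    have "map \<phi> (map ?inv ys) = ys"
      using ys inv(2) by (auto simp: args_def intro!: map_idI)
    then show ?thesis
      using is_homD[OF hom] xs ua by (metis is_ualgebra_def)
  qed
  moreover have "carrier C \<noteq> {}"
    using surj ua by (auto simp: is_ualgebra_def)
  moreover have "satisfies C s t" if st: "(s, t) \<in> \<U>" for s t
    unfolding satisfies_def
  proof (intro allI impI)
    fix \<rho> :: "nat \<Rightarrow> 'c"
    assume \<rho>: "range \<rho> \<subseteq> carrier C"
    let ?\<sigma> = "?inv \<circ> \<rho>"
    have \<sigma>: "range ?\<sigma> \<subseteq> carrier A"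
      using inv(1) \<rho> by auto
    have "\<phi> \<circ> ?\<sigma> = \<rho>"
      using inv(2) \<rho> by (auto simp: fun_eq_iff)
    moreover have "wf_trm ar s" "wf_trm ar t"
      using var st by (auto simp: is_variety_def)
    moreover have "eval A ?\<sigma> s = eval A ?\<sigma> t"
      using A st \<sigma> by (auto simp: in_variety_def satisfies_def)
    ultimately show "eval C \<rho> s = eval C \<rho> t"
      using eval_hom[OF ua hom _ \<sigma>] by metis
  qed
  ultimately show ?thesis
    by (auto simp: in_variety_def is_ualgebra_def)
qed

text \<open>Both sides of an identity have equal images in \<open>A\<close>, and injectivity
  reflects this equality back to \<open>K\<close>.\<close>

lemma in_variety_embedding:
  fixes K :: "('c, 'f) ualgebra"
  assumes var: "is_variety ar \<U>" and A: "in_variety ar \<U> A" and K: "is_ualgebra ar K"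
    and hom: "is_hom ar K A \<phi>" and inj: "inj_on \<phi> (carrier K)"
  shows "in_variety ar \<U> K"
proof -
  have "satisfies K s t" if st: "(s, t) \<in> \<U>" for s t
    unfolding satisfies_def
  proof (intro allI impI)
    fix \<rho> :: "nat \<Rightarrow> 'c"
    assume \<rho>: "range \<rho> \<subseteq> carrier K"
    have wf: "wf_trm ar s" "wf_trm ar t"
      using var st by (auto simp: is_variety_def)
    have "range (\<phi> \<circ> \<rho>) \<subseteq> carrier A"
      using \<rho> is_homD(1)[OF hom] by auto
    then have "eval A (\<phi> \<circ> \<rho>) s = eval A (\<phi> \<circ> \<rho>) t"
      using A st by (auto simp: in_variety_def satisfies_def)
    then have "\<phi> (eval K \<rho> s) = \<phi> (eval K \<rho> t)"
      using eval_hom[OF K hom _ \<rho>] wf by simp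
    then show "eval K \<rho> s = eval K \<rho> t"
      using inj eval_closed[OF K _ \<rho>] wf by (simp add: inj_on_def)
  qed
  then show ?thesis
    using K by (auto simp: in_variety_def)
qed


section \<open>Quotients on a set of representatives\<close>

text \<open>A canonical element of the fibre of \<open>\<kappa>\<close> through \<open>x\<close>.
  Quotients built from such elements, unlike those built from classes, stay in the type of
  \<open>A\<close>.\<close>

definition rep :: "('a, 'f) ualgebra \<Rightarrow> ('a \<Rightarrow> 'c) \<Rightarrow> 'a \<Rightarrow> 'a" where
  "rep A \<kappa> x = inv_into (carrier A) \<kappa> (\<kappa> x)"

definition rep_alg :: "('a, 'f) ualgebra \<Rightarrow> ('a \<Rightarrow> 'c) \<Rightarrow> ('a, 'f) ualgebra" where
  "rep_alg A \<kappa> = \<lparr>carrier = rep A \<kappa> ` carrier A, oper = (\<lambda>f xs. rep A \<kappa> (oper A f xs))\<rparr>"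

text \<open>Says that the kernel of \<open>\<kappa>\<close> respects the operations, without
  requiring operations on the target of \<open>\<kappa>\<close>.\<close>

definition kernel_compatible :: "('f \<Rightarrow> nat) \<Rightarrow> ('a, 'f) ualgebra \<Rightarrow> ('a \<Rightarrow> 'c) \<Rightarrow> bool" where
  "kernel_compatible ar A \<kappa> \<longleftrightarrow>
     (\<forall>f. \<forall>xs\<in>args (carrier A) (ar f). \<forall>ys\<in>args (carrier A) (ar f).
        map \<kappa> xs = map \<kappa> ys \<longrightarrow> \<kappa> (oper A f xs) = \<kappa> (oper A f ys))"

lemma rep_closed: "x \<in> carrier A \<Longrightarrow> rep A \<kappa> x \<in> carrier A"
  by (simp add: rep_def inv_into_into)

lemma kernel_rep: "x \<in> carrier A \<Longrightarrow> \<kappa> (rep A \<kappa> x) = \<kappa> x"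
  by (simp add: rep_def f_inv_into_f)

lemma rep_eq_iff:
  "x \<in> carrier A \<Longrightarrow> y \<in> carrier A \<Longrightarrow> rep A \<kappa> x = rep A \<kappa> y \<longleftrightarrow> \<kappa> x = \<kappa> y"
  by (metis kernel_rep rep_def)

lemma rep_rep: "x \<in> carrier A \<Longrightarrow> rep A \<kappa> (rep A \<kappa> x) = rep A \<kappa> x"
  by (simp add: rep_def f_inv_into_f)

lemma rep_alg_is_hom:
  assumes "is_ualgebra ar A" and "kernel_compatible ar A \<kappa>"
  shows "is_hom ar A (rep_alg A \<kappa>) (rep A \<kappa>)"
proof -
  have "rep A \<kappa> (oper A f xs) = rep A \<kappa> (oper A f (map (rep A \<kappa>) xs))"
    if xs: "xs \<in> args (carrier A) (ar f)" for f xs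
  proof -
    have ys: "map (rep A \<kappa>) xs \<in> args (carrier A) (ar f)"
      using xs by (rule args_map) (rule rep_closed)
    have "map \<kappa> xs = map \<kappa> (map (rep A \<kappa>) xs)"
      using xs by (auto simp: args_def kernel_rep)
    then have "\<kappa> (oper A f xs) = \<kappa> (oper A f (map (rep A \<kappa>) xs))"
      using assms(2) xs ys unfolding kernel_compatible_def by blast
    then show ?thesis
      unfolding rep_def by (rule arg_cong)
  qed
  then show ?thesis
    by (simp add: is_hom_def rep_alg_def)
qed

lemma rep_alg_is_ualgebra:
  assumes "is_ualgebra ar A"
  shows "is_ualgebra ar (rep_alg A \<kappa>)"
proof -
  have "oper A f xs \<in> carrier A" if "xs \<in> args (rep A \<kappa> ` carrier A) (ar f)" for f xs
  proof -
    have "xs \<in> args (carrier A) (ar f)"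
      using that by (rule args_mono) (auto simp: rep_closed)
    then show ?thesis
      using assms by (simp add: is_ualgebra_def)
  qed
  then show ?thesis
    using assms by (auto simp: is_ualgebra_def rep_alg_def)
qed

lemma eval_term_algebra:
  "eval \<lparr>carrier = X, oper = Op\<rparr> Var t = t"
  by (induction t) (simp_all add: map_idI)

text \<open>The subalgebra generated by the values of an assignment has a copy on the type of terms,
  so that \<open>identities\<close> applies to members of the variety on any type.\<close>

lemma identities_satisfied:
  fixes A :: "('a, 'f) ualgebra"
  assumes var: "is_variety ar \<U>" and A: "in_variety ar \<U> A" and st: "(s, t) \<in> identities ar \<U>"
  shows "satisfies A s t"
  unfolding satisfies_def
proof (intro allI impI)
  fix \<rho> :: "nat \<Rightarrow> 'a"
  assume \<rho>: "range \<rho> \<subseteq> carrier A"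
  define W :: "(('f, nat) trm, 'f) ualgebra" where "W = \<lparr>carrier = {t. wf_trm ar t}, oper = Op\<rparr>"
  let ?K = "rep_alg W (eval A \<rho>)" and ?r = "rep W (eval A \<rho>)"
  have ua: "is_ualgebra ar A"
    using A by (simp add: in_variety_def)
  have W: "is_ualgebra ar W"
    by (auto simp: is_ualgebra_def W_def args_def intro: exI[of _ "Var 0"])
  have comp: "kernel_compatible ar W (eval A \<rho>)"
    by (auto simp: kernel_compatible_def W_def)
  have oper_W: "oper W f ts \<in> carrier W" if "ts \<in> args (carrier ?K) (ar f)" for f ts
  proof -
    have "ts \<in> args (carrier W) (ar f)"
      using that by (rule args_mono) (auto simp: rep_closed rep_alg_def)
    then show ?thesis
      using W by (simp add: is_ualgebra_def)
  qed
  \<comment> \<open>A representative has the same value under \<open>\<rho>\<close> as the term it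
    replaces, so evaluation embeds \<open>?K\<close> in \<open>A\<close>.\<close>
  have "is_hom ar ?K A (eval A \<rho>)"
    unfolding is_hom_def
  proof (intro conjI allI ballI funcsetI)
    fix t
    assume "t \<in> carrier ?K"
    then have "t \<in> carrier W"
      using rep_closed[of _ W] by (auto simp: rep_alg_def)
    then show "eval A \<rho> t \<in> carrier A"
      using eval_closed[OF ua _ \<rho>] by (simp add: W_def)
  next
    fix f ts
    assume "ts \<in> args (carrier ?K) (ar f)"
    then have "eval A \<rho> (?r (oper W f ts)) = eval A \<rho> (oper W f ts)"
      by (intro kernel_rep oper_W)
    then show "eval A \<rho> (oper ?K f ts) = oper A f (map (eval A \<rho>) ts)"
      by (simp add: rep_alg_def W_def)
  qed
  moreover have "inj_on (eval A \<rho>) (carrier ?K)"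
    by (auto simp: rep_alg_def inj_on_def kernel_rep rep_eq_iff)
  ultimately have "in_variety ar \<U> ?K"
    using in_variety_embedding[OF var A rep_alg_is_ualgebra[OF W]] by blast
  then have "satisfies ?K s t"
    using st by (auto simp: identities_def)
  \<comment> \<open>Sending each variable to its representative evaluates \<open>s\<close> to the
    representative of \<open>s\<close> itself, so the identity in \<open>?K\<close> says that
    \<open>s\<close> and \<open>t\<close> have equal values under \<open>\<rho>\<close>.\<close>
  moreover have "range (?r \<circ> Var) \<subseteq> carrier ?K"
    by (auto simp: rep_alg_def W_def)
  ultimately have "eval ?K (?r \<circ> Var) s = eval ?K (?r \<circ> Var) t"
    by (simp add: satisfies_def)
  moreover have wf: "wf_trm ar s" "wf_trm ar t"
    using st by (auto simp: identities_def)
  moreover have "range Var \<subseteq> carrier W"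
    by (auto simp: W_def)
  ultimately have "?r (eval W Var s) = ?r (eval W Var t)"
    using eval_hom[OF W rep_alg_is_hom[OF W comp]] by metis
  moreover have "eval W Var s = s" "eval W Var t = t"
    by (simp_all add: W_def eval_term_algebra)
  ultimately show "eval A \<rho> s = eval A \<rho> t"
    using wf by (simp add: rep_eq_iff W_def)
qed


section \<open>The commutator of the full congruence\<close>

lemma con_top_in_Con: "is_ualgebra ar A \<Longrightarrow> con_top A \<in> Con ar A"
  by (auto simp: Con_def con_top_def is_ualgebra_def intro: equivI refl_onI symI transI)

text \<open>The full relation contains every pair of values, so the family of congruences
  intersected in \<open>commutator\<close> is never empty.\<close>

lemma con_top_centralized:
  fixes A :: "('a, 'f) ualgebra"
  assumes "is_ualgebra ar A" and "\<beta> \<subseteq> con_top A" and "\<alpha> \<subseteq> con_top A"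
  shows "centralizes ar A \<alpha> \<beta> (con_top A)"
  unfolding centralizes_def
proof (intro allI impI)
  fix t :: "('f, nat + nat) trm" and a b u v :: "nat \<Rightarrow> 'a"
  assume t: "wf_trm ar t" and ab: "\<forall>i. (a i, b i) \<in> \<alpha>" and uv: "\<forall>j. (u j, v j) \<in> \<beta>"
  have "case_sum b w x \<in> carrier A" if "\<forall>j. w j \<in> carrier A" for w x
    using that ab assms(3) by (cases x) (auto simp: con_top_def)
  moreover have "\<forall>j. u j \<in> carrier A" "\<forall>j. v j \<in> carrier A"
    using uv assms(2) by (auto simp: con_top_def)
  ultimately have "range (case_sum b u) \<subseteq> carrier A" "range (case_sum b v) \<subseteq> carrier A"
    by auto
  then show "(eval A (case_sum b u) t, eval A (case_sum b v) t) \<in> con_top A"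
    using eval_closed[OF assms(1) t] by (simp add: con_top_def)
qed

lemma commutator_in_Con:
  assumes "is_ualgebra ar A" and "\<beta> \<subseteq> con_top A" and "\<alpha> \<subseteq> con_top A"
  shows "commutator ar A \<alpha> \<beta> \<in> Con ar A"
proof -
  let ?D = "{\<delta> \<in> Con ar A. centralizes ar A \<alpha> \<beta> \<delta>}"
  \<comment> \<open>An intersection over the empty family would be the universal relation on the
    whole type instead of one on the carrier.\<close>
  have ne: "con_top A \<in> ?D"
    using con_top_in_Con con_top_centralized assms by blast
  have "equiv (carrier A) (\<Inter>?D)"
  proof (rule equivI)
    show "\<Inter>?D \<subseteq> carrier A \<times> carrier A"
      using ne by (auto simp: con_top_def)
    show "refl_on (carrier A) (\<Inter>?D)"
      by (auto simp: Con_def equiv_def refl_on_def)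
    show "sym (\<Inter>?D)"
      by (auto simp: Con_def equiv_def sym_def)
    show "trans (\<Inter>?D)"
      unfolding trans_def by (auto simp: Con_def equiv_def dest: transD)
  qed
  moreover have "(oper A f xs, oper A f ys) \<in> \<Inter>?D"
    if "xs \<in> args (carrier A) (ar f)" "ys \<in> args (carrier A) (ar f)"
      and "\<forall>i<ar f. (xs ! i, ys ! i) \<in> \<Inter>?D" for f xs ys
    using that by (fastforce simp: Con_def)
  ultimately show ?thesis
    unfolding commutator_def by (subst Con_def) blast
qed

text \<open>The term condition passes to intersections of \<open>\<delta>\<close>, since a premise
  lying in the intersection lies in every member.\<close>

lemma commutator_centralized: "centralizes ar A \<alpha> \<beta> (commutator ar A \<alpha> \<beta>)"
  unfolding commutator_def centralizes_def by blast


section \<open>Kernel algebras are affine\<close>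

locale kernel_alg =
  fixes ar :: "'f \<Rightarrow> nat" and m :: 'f and R :: "'r ring" and B :: "('r, 'a, 'f) kernel_algebra"
  assumes kernel_algebra: "is_kernel_algebra ar m R B"
begin

sublocale unital_left_module R B
  using kernel_algebra by (simp add: is_kernel_algebra_def)

lemma kop_sum:
  obtains r where "r \<in> {..<ar f} \<rightarrow> carrier R"
    and "\<And>xs. xs \<in> args (carrier B) (ar f) \<Longrightarrow>
      kop B f xs = (\<Oplus>\<^bsub>B\<^esub>i\<in>{..<ar f}. r i \<odot>\<^bsub>B\<^esub> xs ! i)"
  using kernel_algebra unfolding is_kernel_algebra_def by meson

lemma kop_difference:
  "\<lbrakk>x \<in> carrier B; y \<in> carrier B; z \<in> carrier B\<rbrakk> \<Longrightarrow>
    kop B m [x, y, z] = (x \<ominus>\<^bsub>B\<^esub> y) \<oplus>\<^bsub>B\<^esub> z"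
  using kernel_algebra by (simp add: is_kernel_algebra_def)

lemma kop_closed:
  assumes xs: "xs \<in> args (carrier B) (ar f)"
  shows "kop B f xs \<in> carrier B"
proof -
  obtain r where r: "r \<in> {..<ar f} \<rightarrow> carrier R"
    and "kop B f xs = (\<Oplus>\<^bsub>B\<^esub>i\<in>{..<ar f}. r i \<odot>\<^bsub>B\<^esub> xs ! i)"
    using kop_sum[of f] xs by metis
  moreover have "r i \<odot>\<^bsub>B\<^esub> xs ! i \<in> carrier B" if "i < ar f" for i
    using that r xs by (intro smult_closed) (auto simp: args_def)
  ultimately show ?thesis
    by (auto intro: M.finsum_closed)
qed

lemma is_ualgebra_alg: "is_ualgebra ar (alg B)"
  using kop_closed M.zero_closed by (auto simp: is_ualgebra_def alg_def)

text \<open>Module terms are additive. Indexing by an arbitrary list \<open>xs\<close>, with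
  \<open>g\<close> and \<open>h\<close> producing the summands, lets lists of elements, terms or
  pairs be used alike.\<close>

lemma kop_add:
  assumes xs: "length xs = ar f"
    and g: "\<And>x. x \<in> set xs \<Longrightarrow> g x \<in> carrier B" and h: "\<And>x. x \<in> set xs \<Longrightarrow> h x \<in> carrier B"
  shows "kop B f (map (\<lambda>x. g x \<oplus>\<^bsub>B\<^esub> h x) xs) = kop B f (map g xs) \<oplus>\<^bsub>B\<^esub> kop B f (map h xs)"
proof -
  obtain r where r: "r \<in> {..<ar f} \<rightarrow> carrier R"
    and kop: "\<And>xs. xs \<in> args (carrier B) (ar f) \<Longrightarrow>
      kop B f xs = (\<Oplus>\<^bsub>B\<^esub>i\<in>{..<ar f}. r i \<odot>\<^bsub>B\<^esub> xs ! i)"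
    using kop_sum[of f] by metis
  have "kop B f (map (\<lambda>x. g x \<oplus>\<^bsub>B\<^esub> h x) xs) =
      (\<Oplus>\<^bsub>B\<^esub>i\<in>{..<ar f}. r i \<odot>\<^bsub>B\<^esub> map (\<lambda>x. g x \<oplus>\<^bsub>B\<^esub> h x) xs ! i)"
    using xs g h by (intro kop) (auto simp: args_def)
  also have "\<dots> = (\<Oplus>\<^bsub>B\<^esub>i\<in>{..<ar f}. r i \<odot>\<^bsub>B\<^esub> map g xs ! i \<oplus>\<^bsub>B\<^esub> r i \<odot>\<^bsub>B\<^esub> map h xs ! i)"
    using xs g h r by (intro M.finsum_cong') (auto intro!: smult_r_distr smult_closed M.add.m_closed)
  also have "\<dots> = (\<Oplus>\<^bsub>B\<^esub>i\<in>{..<ar f}. r i \<odot>\<^bsub>B\<^esub> map g xs ! i) \<oplus>\<^bsub>B\<^esub>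
      (\<Oplus>\<^bsub>B\<^esub>i\<in>{..<ar f}. r i \<odot>\<^bsub>B\<^esub> map h xs ! i)"
    using xs g h r by (intro M.finsum_addf) (auto intro!: smult_closed)
  also have "(\<Oplus>\<^bsub>B\<^esub>i\<in>{..<ar f}. r i \<odot>\<^bsub>B\<^esub> map g xs ! i) = kop B f (map g xs)"
    using xs g by (intro kop[symmetric]) (auto simp: args_def)
  also have "(\<Oplus>\<^bsub>B\<^esub>i\<in>{..<ar f}. r i \<odot>\<^bsub>B\<^esub> map h xs ! i) = kop B f (map h xs)"
    using xs h by (intro kop[symmetric]) (auto simp: args_def)
  finally show ?thesis .
qed

lemma kop_map_closed:
  "length xs = ar f \<Longrightarrow> (\<And>x. x \<in> set xs \<Longrightarrow> g x \<in> carrier B) \<Longrightarrow> kop B f (map g xs) \<in> carrier B"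
  by (rule kop_closed) (auto simp: args_def)

lemma kop_minus:
  assumes xs: "length xs = ar f"
    and g: "\<And>x. x \<in> set xs \<Longrightarrow> g x \<in> carrier B" and h: "\<And>x. x \<in> set xs \<Longrightarrow> h x \<in> carrier B"
  shows "kop B f (map (\<lambda>x. g x \<ominus>\<^bsub>B\<^esub> h x) xs) = kop B f (map g xs) \<ominus>\<^bsub>B\<^esub> kop B f (map h xs)"
proof -
  \<comment> \<open>Additivity is applied to the summands \<open>g - h\<close> and \<open>h\<close>,
    which restore \<open>g\<close>.\<close>
  have "kop B f (map g xs) = kop B f (map (\<lambda>x. (g x \<ominus>\<^bsub>B\<^esub> h x) \<oplus>\<^bsub>B\<^esub> h x) xs)"
    using g h by (intro arg_cong[of _ _ "kop B f"]) (auto simp: M.minus_eq M.a_assoc M.l_neg)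
  also have "\<dots> = kop B f (map (\<lambda>x. g x \<ominus>\<^bsub>B\<^esub> h x) xs) \<oplus>\<^bsub>B\<^esub> kop B f (map h xs)"
    using xs g h by (intro kop_add) auto
  finally show ?thesis
    using xs g h by (simp add: kop_map_closed M.minus_eq M.a_assoc M.r_neg)
qed

lemma kop_zero:
  assumes "length xs = ar f"
  shows "kop B f (map (\<lambda>_. \<zero>\<^bsub>B\<^esub>) xs) = \<zero>\<^bsub>B\<^esub>"
  using kop_minus[of xs f "\<lambda>_. \<zero>\<^bsub>B\<^esub>" "\<lambda>_. \<zero>\<^bsub>B\<^esub>"] assms
  by (simp add: M.minus_eq M.r_neg kop_map_closed)

text \<open>Every basic operation is additive, hence commutes with \<open>x - y + z\<close>;
  induction carries this to terms.\<close>

lemma eval_affine: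
  assumes t: "wf_trm ar t"
    and \<rho>: "range \<rho> \<subseteq> carrier B" and \<sigma>: "range \<sigma> \<subseteq> carrier B" and \<tau>: "range \<tau> \<subseteq> carrier B"
  shows "eval (alg B) (\<lambda>x. (\<rho> x \<ominus>\<^bsub>B\<^esub> \<sigma> x) \<oplus>\<^bsub>B\<^esub> \<tau> x) t =
    (eval (alg B) \<rho> t \<ominus>\<^bsub>B\<^esub> eval (alg B) \<sigma> t) \<oplus>\<^bsub>B\<^esub> eval (alg B) \<tau> t"
  using t
proof (induction t)
  case (Op f ts)
  have closed: "eval (alg B) \<upsilon> t \<in> carrier B" if "t \<in> set ts" "range \<upsilon> \<subseteq> carrier B" for t \<upsilon>
    using eval_closed[OF is_ualgebra_alg, of t \<upsilon>] that Op.prems by (simp add: alg_def)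
  let ?e = "\<lambda>\<upsilon>. eval (alg B) \<upsilon>"
  have "kop B f (map (?e (\<lambda>x. (\<rho> x \<ominus>\<^bsub>B\<^esub> \<sigma> x) \<oplus>\<^bsub>B\<^esub> \<tau> x)) ts) =
      kop B f (map (\<lambda>t. (?e \<rho> t \<ominus>\<^bsub>B\<^esub> ?e \<sigma> t) \<oplus>\<^bsub>B\<^esub> ?e \<tau> t) ts)"
    using Op by (intro arg_cong[of _ _ "kop B f"]) simp
  also have "\<dots> = (kop B f (map (?e \<rho>) ts) \<ominus>\<^bsub>B\<^esub> kop B f (map (?e \<sigma>) ts)) \<oplus>\<^bsub>B\<^esub> kop B f (map (?e \<tau>) ts)"
    using Op.prems closed \<rho> \<sigma> \<tau> by (simp add: kop_add kop_minus)
  finally show ?case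
    by (simp add: alg_def)
qed simp

text \<open>Terms are affine, so \<open>t(b,v) = t(b,u) - t(a,u) + t(a,v)\<close>.\<close>

lemma commutator_le_kernel:
  fixes A :: "('c, 'f) ualgebra"
  assumes A: "is_ualgebra ar A" and g: "is_hom ar A (alg B) g"
  shows "commutator ar A (con_top A) (con_top A) \<subseteq> ker_of A g"
proof -
  have "ker_of A g \<in> Con ar A"
  proof -
    have "(oper A f xs, oper A f ys) \<in> ker_of A g"
      if xs: "xs \<in> args (carrier A) (ar f)" and ys: "ys \<in> args (carrier A) (ar f)"
        and eq: "\<forall>i<ar f. (xs ! i, ys ! i) \<in> ker_of A g" for f xs ys
    proof -
      have "map g xs = map g ys"
        using xs ys eq by (auto simp: args_def ker_of_def intro: nth_equalityI)
      then show ?thesis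
        using A is_homD(2)[OF g] xs ys by (simp add: ker_of_def is_ualgebra_def)
    qed
    moreover have "equiv (carrier A) (ker_of A g)"
      by (rule equivI) (auto simp: ker_of_def refl_on_def sym_def trans_def)
    ultimately show ?thesis
      by (simp add: Con_def)
  qed
  moreover have "centralizes ar A (con_top A) (con_top A) (ker_of A g)"
    unfolding centralizes_def
  proof (intro allI impI)
    fix t :: "('f, nat + nat) trm" and a b u v :: "nat \<Rightarrow> 'c"
    assume t: "wf_trm ar t" and ab: "\<forall>i. (a i, b i) \<in> con_top A"
      and uv: "\<forall>j. (u j, v j) \<in> con_top A"
      and eq: "(eval A (case_sum a u) t, eval A (case_sum a v) t) \<in> ker_of A g"
    have range: "range (case_sum c w) \<subseteq> carrier A" if "c = a \<or> c = b" "w = u \<or> w = v" for c w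
      using that ab uv by (auto simp: con_top_def split: sum.split)
    have A_closed: "eval A (case_sum c w) t \<in> carrier A" if "c = a \<or> c = b" "w = u \<or> w = v" for c w
      using range[OF that] by (rule eval_closed[OF A t])
    have g_eval: "g (eval A (case_sum c w) t) = eval (alg B) (g \<circ> case_sum c w) t"
      if "c = a \<or> c = b" "w = u \<or> w = v" for c w
      using range[OF that] by (rule eval_hom[OF A g t])
    have B_range: "range (g \<circ> case_sum c w) \<subseteq> carrier B" if "c = a \<or> c = b" "w = u \<or> w = v" for c w
      using range[OF that] is_homD(1)[OF g] by (auto simp: alg_def)
    have B_closed: "g (eval A (case_sum c w) t) \<in> carrier B"
      if "c = a \<or> c = b" "w = u \<or> w = v" for c w
      using A_closed[OF that] is_homD(1)[OF g] by (auto simp: alg_def)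
    have gB: "g x \<in> carrier B" if "x \<in> carrier A" for x
      using is_homD(1)[OF g that] by (simp add: alg_def)
    \<comment> \<open>On variables of the first block the right side is \<open>b - a + a\<close>, on
      those of the second \<open>u - u + v\<close>, each taken under \<open>g\<close>.\<close>
    have "g \<circ> case_sum b v =
        (\<lambda>x. ((g \<circ> case_sum b u) x \<ominus>\<^bsub>B\<^esub> (g \<circ> case_sum a u) x) \<oplus>\<^bsub>B\<^esub> (g \<circ> case_sum a v) x)"
    proof
      fix x :: "nat + nat"
      show "(g \<circ> case_sum b v) x =
        ((g \<circ> case_sum b u) x \<ominus>\<^bsub>B\<^esub> (g \<circ> case_sum a u) x) \<oplus>\<^bsub>B\<^esub> (g \<circ> case_sum a v) x"
        using ab uv gB
        by (cases x) (auto simp: con_top_def M.minus_eq M.a_assoc M.l_neg M.r_neg)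
    qed
    then have "g (eval A (case_sum b v) t) =
        (g (eval A (case_sum b u) t) \<ominus>\<^bsub>B\<^esub> g (eval A (case_sum a u) t)) \<oplus>\<^bsub>B\<^esub> g (eval A (case_sum a v) t)"
      using eval_affine[OF t B_range B_range B_range, of b u a u a v] g_eval by simp
    \<comment> \<open>The premise equates the two values at \<open>a\<close>, which therefore
      cancel.\<close>
    also have "\<dots> = g (eval A (case_sum b u) t)"
      using eq B_closed by (simp add: ker_of_def M.minus_eq M.a_assoc M.l_neg)
    finally show "(eval A (case_sum b u) t, eval A (case_sum b v) t) \<in> ker_of A g"
      using A_closed by (simp add: ker_of_def)
  qed
  ultimately show ?thesis
    by (auto simp: commutator_def)
qed

end


section \<open>Abelian Mal'cev algebras with an idempotent element\<close>

text \<open>Scalars for the module built below. The functions are extensional, so that ring laws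
  checked on the carrier are genuine equalities, and their type is the one that \<open>RD2\<close>
  prescribes for its rings.\<close>

definition End_ring :: "('a, 'x) ring_scheme \<Rightarrow> ('a \<Rightarrow> 'a) ring" where
  "End_ring M =
     \<lparr>carrier = {\<phi> \<in> carrier M \<rightarrow>\<^sub>E carrier M. \<forall>x\<in>carrier M. \<forall>y\<in>carrier M.
                   \<phi> (x \<oplus>\<^bsub>M\<^esub> y) = \<phi> x \<oplus>\<^bsub>M\<^esub> \<phi> y},
      mult = (\<lambda>\<phi> \<psi>. \<lambda>x\<in>carrier M. \<phi> (\<psi> x)),
      one = (\<lambda>x\<in>carrier M. x),
      zero = (\<lambda>x\<in>carrier M. \<zero>\<^bsub>M\<^esub>),
      add = (\<lambda>\<phi> \<psi>. \<lambda>x\<in>carrier M. \<phi> x \<oplus>\<^bsub>M\<^esub> \<psi> x)\<rparr>"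

section \<open>The ring of additive endomorphisms\<close>

context abelian_group
begin

lemma End_ring_apply:
  assumes "x \<in> carrier G"
  shows "\<phi> \<in> carrier (End_ring G) \<Longrightarrow> \<phi> x \<in> carrier G"
    and "\<phi> \<in> carrier (End_ring G) \<Longrightarrow> y \<in> carrier G \<Longrightarrow> \<phi> (x \<oplus> y) = \<phi> x \<oplus> \<phi> y"
    and "(\<phi> \<oplus>\<^bsub>End_ring G\<^esub> \<psi>) x = \<phi> x \<oplus> \<psi> x"
    and "(\<phi> \<otimes>\<^bsub>End_ring G\<^esub> \<psi>) x = \<phi> (\<psi> x)"
    and "\<zero>\<^bsub>End_ring G\<^esub> x = \<zero>"
    and "\<one>\<^bsub>End_ring G\<^esub> x = x"
  using assms by (auto simp: End_ring_def)

lemma End_ringI: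
  assumes "\<And>x. x \<in> carrier G \<Longrightarrow> \<phi> x \<in> carrier G"
    and "\<And>x y. x \<in> carrier G \<Longrightarrow> y \<in> carrier G \<Longrightarrow> \<phi> (x \<oplus> y) = \<phi> x \<oplus> \<phi> y"
  shows "restrict \<phi> (carrier G) \<in> carrier (End_ring G)"
  using assms by (auto simp: End_ring_def)

lemma End_ring_eqI:
  assumes "\<phi> \<in> carrier (End_ring G)" and "\<psi> \<in> carrier (End_ring G)"
    and "\<And>x. x \<in> carrier G \<Longrightarrow> \<phi> x = \<psi> x"
  shows "\<phi> = \<psi>"
  using assms by (auto simp: End_ring_def intro: PiE_ext)

lemma End_ring_closed:
  "\<phi> \<in> carrier (End_ring G) \<Longrightarrow> \<psi> \<in> carrier (End_ring G) \<Longrightarrow> \<phi> \<oplus>\<^bsub>End_ring G\<^esub> \<psi> \<in> carrier (End_ring G)"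
  "\<phi> \<in> carrier (End_ring G) \<Longrightarrow> \<psi> \<in> carrier (End_ring G) \<Longrightarrow> \<phi> \<otimes>\<^bsub>End_ring G\<^esub> \<psi> \<in> carrier (End_ring G)"
  "\<zero>\<^bsub>End_ring G\<^esub> \<in> carrier (End_ring G)"
  "\<one>\<^bsub>End_ring G\<^esub> \<in> carrier (End_ring G)"
  by (auto simp: End_ring_def PiE_iff a_ac)

lemma ring_End_ring: "ring (End_ring G)"
proof (rule ringI)
  show "abelian_group (End_ring G)"
  proof (rule abelian_groupI)
    fix \<phi>
    assume \<phi>: "\<phi> \<in> carrier (End_ring G)"
    \<comment> \<open>Pointwise negation is additive because the group is commutative.\<close>
    let ?neg = "\<lambda>x\<in>carrier G. \<ominus> \<phi> x"
    have neg: "?neg \<in> carrier (End_ring G)"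
      using \<phi> by (intro End_ringI) (simp_all add: End_ring_apply minus_add a_comm)
    moreover have "?neg \<oplus>\<^bsub>End_ring G\<^esub> \<phi> = \<zero>\<^bsub>End_ring G\<^esub>"
      using \<phi> neg by (intro End_ring_eqI) (simp_all add: End_ring_closed End_ring_apply l_neg)
    ultimately show "\<exists>\<psi>\<in>carrier (End_ring G). \<psi> \<oplus>\<^bsub>End_ring G\<^esub> \<phi> = \<zero>\<^bsub>End_ring G\<^esub>"
      by blast
  qed (auto intro!: End_ring_eqI simp: End_ring_closed End_ring_apply a_ac)
  show "monoid (End_ring G)"
    by (rule monoidI) (auto intro!: End_ring_eqI simp: End_ring_closed End_ring_apply)
qed (auto intro!: End_ring_eqI simp: End_ring_closed End_ring_apply)

end

text \<open>\<open>abelian\<close> is the term condition \<open>C(1,1;0)\<close>; \<open>Id\<close>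
  may stand for equality on the carrier because values of terms lie there. The idempotent
  \<open>z\<close> is going to be the zero of a module.\<close>

locale abelian_malcev =
  fixes ar :: "'f \<Rightarrow> nat" and m :: 'f and C :: "('a, 'f) ualgebra" and z :: 'a
  assumes ualgebra: "is_ualgebra ar C" and arity: "ar m = 3"
    and mal_left: "\<lbrakk>x \<in> carrier C; y \<in> carrier C\<rbrakk> \<Longrightarrow> oper C m [x, x, y] = y"
    and mal_right: "\<lbrakk>x \<in> carrier C; y \<in> carrier C\<rbrakk> \<Longrightarrow> oper C m [x, y, y] = x"
    and abelian: "centralizes ar C (con_top C) (con_top C) Id"
    and idempotent: "idempotent_element ar C z"
begin

abbreviation d :: "'a \<Rightarrow> 'a \<Rightarrow> 'a \<Rightarrow> 'a" where
  "d x y w \<equiv> oper C m [x, y, w]"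

lemma z_closed: "z \<in> carrier C"
  using idempotent by (simp add: idempotent_element_def)

lemma d_closed: "\<lbrakk>x \<in> carrier C; y \<in> carrier C; w \<in> carrier C\<rbrakk> \<Longrightarrow> d x y w \<in> carrier C"
  using ualgebra arity by (auto simp: is_ualgebra_def args_def)

lemma oper_map_closed:
  assumes "length is = ar f" and "\<And>i. i \<in> set is \<Longrightarrow> X i \<in> carrier C"
  shows "oper C f (map X is) \<in> carrier C"
proof -
  have "map X is \<in> args (carrier C) (ar f)"
    using assms by (auto simp: args_def)
  then show ?thesis
    using ualgebra by (simp add: is_ualgebra_def)
qed

text \<open>The term condition is applied to the term
  \<open>d (f (d x\<^sub>i y\<^sub>i w\<^sub>i)) (d (f x) (f y) (f w)) e\<close>, whose value is \<open>e\<close> whenever \<open>w = y\<close> or \<open>x = y\<close>.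
  The first block of variables holds \<open>e\<close> and \<open>x\<close>, the second one \<open>w\<close> and \<open>y\<close>.\<close>

lemma oper_commutes_d:
  fixes X Y W :: "nat \<Rightarrow> 'a"
  assumes X: "\<And>i. X i \<in> carrier C" and Y: "\<And>i. Y i \<in> carrier C" and W: "\<And>i. W i \<in> carrier C"
  shows "oper C f (map (\<lambda>i. d (X i) (Y i) (W i)) [0..<ar f]) =
    d (oper C f (map X [0..<ar f])) (oper C f (map Y [0..<ar f])) (oper C f (map W [0..<ar f]))"
proof -
  let ?x = "\<lambda>i. Var (Inl (Suc i)) :: ('f, nat + nat) trm"
  let ?e = "Var (Inl 0) :: ('f, nat + nat) trm"
  let ?y = "\<lambda>i. Var (Inr (2 * i)) :: ('f, nat + nat) trm"
  let ?w = "\<lambda>i. Var (Inr (2 * i + 1)) :: ('f, nat + nat) trm"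
  let ?f = "\<lambda>v. Op f (map v [0..<ar f]) :: ('f, nat + nat) trm"
  define t where "t = Op m [?f (\<lambda>i. Op m [?x i, ?y i, ?w i]), Op m [?f ?x, ?f ?y, ?f ?w], ?e]"
  define l where "l e X i = (case i of 0 \<Rightarrow> e | Suc i \<Rightarrow> X i)" for e :: 'a and X i
  define r where "r Y W i = (if even i then Y (i div 2) else W (i div 2))" for Y W :: "nat \<Rightarrow> 'a" and i
  have eval_t: "eval C (case_sum (l e X) (r Y W)) t =
      d (oper C f (map (\<lambda>i. d (X i) (Y i) (W i)) [0..<ar f]))
        (d (oper C f (map X [0..<ar f])) (oper C f (map Y [0..<ar f])) (oper C f (map W [0..<ar f]))) e"
    for e X Y W
    by (simp add: t_def l_def r_def comp_def)
  let ?F = "\<lambda>X. oper C f (map X [0..<ar f])"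
  have F: "?F V \<in> carrier C" if "\<And>i. V i \<in> carrier C" for V
    using that by (intro oper_map_closed) auto
  \<comment> \<open>With the right-hand side as \<open>e\<close>, the last two arguments of the
    outer \<open>d\<close> in \<open>t\<close> coincide, so that it returns its first
    argument.\<close>
  define e where "e = d (?F X) (?F Y) (?F W)"
  have e: "e \<in> carrier C"
    using F X Y W by (simp add: e_def d_closed)
  have "wf_trm ar t"
    by (auto simp: t_def arity)
  \<comment> \<open>The first block passes from \<open>Y\<close> to \<open>X\<close>. At
    \<open>Y\<close> both values of \<open>t\<close> are \<open>e\<close>, whether the second block
    repeats \<open>Y\<close> or contains \<open>W\<close>; the term condition then equates the two
    values at \<open>X\<close>.\<close>
  moreover have "\<forall>i. (l e Y i, l e X i) \<in> con_top C"
    using e X Y by (auto simp: l_def con_top_def split: nat.split)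
  moreover have "\<forall>i. (r Y Y i, r Y W i) \<in> con_top C"
    using Y W by (auto simp: r_def con_top_def)
  moreover have "(eval C (case_sum (l e Y) (r Y Y)) t, eval C (case_sum (l e Y) (r Y W)) t) \<in> Id"
    using F Y W e by (simp add: eval_t mal_left mal_right)
  ultimately have "(eval C (case_sum (l e X) (r Y Y)) t, eval C (case_sum (l e X) (r Y W)) t) \<in> Id"
    using abelian unfolding centralizes_def by blast
  then have "e = d (?F (\<lambda>i. d (X i) (Y i) (W i))) e e"
    using F X Y e by (simp add: eval_t mal_left mal_right flip: e_def)
  then show ?thesis
    using F[of "\<lambda>i. d (X i) (Y i) (W i)"] X Y W e by (simp add: mal_right d_closed flip: e_def)
qed

lemma d_commutes_d:
  assumes "x1 \<in> carrier C" "y1 \<in> carrier C" "w1 \<in> carrier C"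
    and "x2 \<in> carrier C" "y2 \<in> carrier C" "w2 \<in> carrier C"
    and "x3 \<in> carrier C" "y3 \<in> carrier C" "w3 \<in> carrier C"
  shows "d (d x1 y1 w1) (d x2 y2 w2) (d x3 y3 w3) = d (d x1 x2 x3) (d y1 y2 y3) (d w1 w2 w3)"
proof -
  \<comment> \<open>\<open>oper_commutes_d\<close> expects sequences on all of \<open>nat\<close>,
    so the third entry is repeated from index 2 on.\<close>
  let ?v = "\<lambda>a b c i :: nat. if i = 0 then a else if i = 1 then b else c :: 'a"
  have "[0..<ar m] = [0, 1, 2]"
    by (simp add: arity upt_rec)
  then show ?thesis
    using oper_commutes_d[of "?v x1 x2 x3" "?v y1 y2 y3" "?v w1 w2 w3" m] assms by simp
qed

text \<open>The linearization of \<open>C\<close> at \<open>z\<close>, with endomorphisms as scalars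
  acting by application. The operations of \<open>C\<close> are kept, so that \<open>alg M\<close>
  is \<open>C\<close> itself.\<close>

definition M :: "('a \<Rightarrow> 'a, 'a, 'f) kernel_algebra" where
  "M = \<lparr>carrier = carrier C, mult = undefined, one = undefined, zero = z,
        add = (\<lambda>x y. d x z y), smult = (\<lambda>\<phi> x. \<phi> x), kop = oper C\<rparr>"

lemma M_simps [simp]:
  "carrier M = carrier C" "\<zero>\<^bsub>M\<^esub> = z" "x \<oplus>\<^bsub>M\<^esub> y = d x z y" "\<phi> \<odot>\<^bsub>M\<^esub> x = \<phi> x" "kop M = oper C"
  by (simp_all add: M_def)

lemma alg_M: "alg M = C"
  by (simp add: alg_def)

text \<open>Like the next two lemmas, an instance of the interchange law \<open>d_commutes_d\<close>
  on a 3 by 3 array padded with \<open>z\<close>, whose rows and columns collapse by the Mal'cev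
  laws. With \<open>v = z\<close> it is associativity of addition; a general \<open>v\<close> later
  brings \<open>m\<close> into the form \<open>x - y + w\<close>.\<close>

lemma d_assoc:
  assumes "x \<in> carrier C" "y \<in> carrier C" "w \<in> carrier C" "v \<in> carrier C"
  shows "d (d x v y) z w = d x v (d y z w)"
  using d_commutes_d[of x v y z z z z z w] assms z_closed by (simp add: mal_left mal_right)

lemma d_comm:
  assumes "x \<in> carrier C" "y \<in> carrier C"
  shows "d x z y = d y z x"
  using d_commutes_d[of z z y z z z x z z] assms z_closed by (simp add: mal_left mal_right)

text \<open>Identifies \<open>d z y z\<close> as the additive inverse of \<open>y\<close>: for
  \<open>x = y\<close> the right side is \<open>z\<close>.\<close>

lemma d_neg:
  assumes "x \<in> carrier C" "y \<in> carrier C"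
  shows "d x z (d z y z) = d x y z"
  using d_commutes_d[of x z z z z z z y z] d_commutes_d[of x z z z z y z z z] assms z_closed
  by (simp add: mal_left mal_right)

lemma abelian_group_M: "abelian_group M"
proof (rule abelian_groupI)
  fix x
  assume "x \<in> carrier M"
  then show "\<exists>y\<in>carrier M. y \<oplus>\<^bsub>M\<^esub> x = \<zero>\<^bsub>M\<^esub>"
    using d_neg[of x x] d_comm[of x "d z x z"] d_closed z_closed mal_left
    by (intro bexI[of _ "d z x z"]) simp_all
qed (use z_closed in \<open>auto simp: d_closed d_assoc mal_left intro: d_comm\<close>)

sublocale M: abelian_group M
  by (rule abelian_group_M)

lemma M_minus:
  assumes "x \<in> carrier C" "y \<in> carrier C"
  shows "x \<ominus>\<^bsub>M\<^esub> y = d x y z"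
proof -
  have "\<ominus>\<^bsub>M\<^esub> y = d z y z"
    using d_neg[of y y] assms d_closed z_closed mal_left by (intro M.minus_equality) (simp_all add: d_comm)
  then show ?thesis
    using assms d_neg by (simp add: M.minus_eq)
qed

text \<open>The coefficient of \<open>f\<close> at argument \<open>i\<close>, read off by putting
  the zero \<open>z\<close> into all other places.\<close>

definition coord :: "'f \<Rightarrow> nat \<Rightarrow> 'a \<Rightarrow> 'a" where
  "coord f i = (\<lambda>x\<in>carrier C. oper C f (map (\<lambda>j. if j = i then x else z) [0..<ar f]))"

lemma oper_z: "oper C f (map (\<lambda>_. z) [0..<ar f]) = z"
  using idempotent by (simp add: idempotent_element_def map_replicate_const)

text \<open>Takes the constant \<open>z\<close> for the middle arguments in
  \<open>oper_commutes_d\<close>; as \<open>z\<close> is idempotent, \<open>f\<close> has no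
  constant term.\<close>

lemma oper_add:
  assumes "\<And>i. X i \<in> carrier C" and "\<And>i. Y i \<in> carrier C"
  shows "oper C f (map (\<lambda>i. X i \<oplus>\<^bsub>M\<^esub> Y i) [0..<ar f]) =
    oper C f (map X [0..<ar f]) \<oplus>\<^bsub>M\<^esub> oper C f (map Y [0..<ar f])"
  using oper_commutes_d[of X "\<lambda>_. z" Y f] assms z_closed by (simp add: oper_z)

lemma coord_in_End: "coord f i \<in> carrier (End_ring M)"
  unfolding coord_def M_simps(1)[symmetric]
proof (rule M.End_ringI)
  fix x y
  assume xy: "x \<in> carrier M" "y \<in> carrier M"
  \<comment> \<open>Away from \<open>i\<close> both functions agree because
    \<open>z + z = z\<close>.\<close>
  have "(\<lambda>j. if j = i then x \<oplus>\<^bsub>M\<^esub> y else z) =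
      (\<lambda>j. (if j = i then x else z) \<oplus>\<^bsub>M\<^esub> (if j = i then y else z))"
    using z_closed by (auto simp: mal_left)
  then show "oper C f (map (\<lambda>j. if j = i then x \<oplus>\<^bsub>M\<^esub> y else z) [0..<ar f]) =
      oper C f (map (\<lambda>j. if j = i then x else z) [0..<ar f]) \<oplus>\<^bsub>M\<^esub>
      oper C f (map (\<lambda>j. if j = i then y else z) [0..<ar f])"
    using oper_add[of "\<lambda>j. if j = i then x else z" "\<lambda>j. if j = i then y else z" f] xy z_closed
    by (simp del: M_simps(3))
qed (use z_closed in \<open>auto intro!: oper_map_closed\<close>)

text \<open>Induction on the number \<open>k\<close> of arguments already switched on: those from
  \<open>k\<close> on are held at \<open>z\<close>, and passing to \<open>k + 1\<close> adds the
  single contribution \<open>coord f k (X k)\<close>.\<close>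

lemma oper_eq_sum_coord:
  assumes X: "\<And>i. X i \<in> carrier C"
  shows "oper C f (map X [0..<ar f]) = (\<Oplus>\<^bsub>M\<^esub>i\<in>{..<ar f}. coord f i (X i))"
proof -
  have coord: "coord f i (X i) \<in> carrier M" for i
    using M.End_ring_apply(1)[OF _ coord_in_End] X by simp
  have "oper C f (map (\<lambda>i. if i < k then X i else z) [0..<ar f]) =
      (\<Oplus>\<^bsub>M\<^esub>i\<in>{..<k}. coord f i (X i))" for k
  proof (induction k)
    case (Suc k)
    let ?X = "\<lambda>i. if i < k then X i else z" and ?Y = "\<lambda>i. if i = k then X k else z"
    have "(\<lambda>i. if i < Suc k then X i else z) = (\<lambda>i. ?X i \<oplus>\<^bsub>M\<^esub> ?Y i)"
      using X z_closed by (auto simp: fun_eq_iff mal_left mal_right less_Suc_eq)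
    then have "oper C f (map (\<lambda>i. if i < Suc k then X i else z) [0..<ar f]) =
        oper C f (map ?X [0..<ar f]) \<oplus>\<^bsub>M\<^esub> oper C f (map ?Y [0..<ar f])"
      using oper_add[of ?X ?Y f] X z_closed by (simp del: M_simps(3))
    also have "oper C f (map ?Y [0..<ar f]) = coord f k (X k)"
      using X by (simp add: coord_def)
    finally show ?case
      using coord by (simp add: Suc.IH lessThan_Suc M.a_comm del: M_simps)
  qed (simp add: oper_z)
  moreover have "map (\<lambda>i. if i < ar f then X i else z) [0..<ar f] = map X [0..<ar f]"
    by simp
  ultimately show ?thesis
    by metis
qed

lemma is_kernel_algebra_M: "is_kernel_algebra ar m (End_ring M) M"
  unfolding is_kernel_algebra_def
proof (intro conjI allI ballI)
  interpret End: ring "End_ring M"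
    by (rule M.ring_End_ring)
  show "unital_left_module (End_ring M) M"
    by unfold_locales
      (use M.End_ring_apply M_simps in \<open>simp_all del: M_simps(1-3,5)\<close>)
next
  fix f
  show "\<exists>r\<in>{..<ar f} \<rightarrow> carrier (End_ring M). \<forall>xs\<in>args (carrier M) (ar f).
      kop M f xs = (\<Oplus>\<^bsub>M\<^esub>i\<in>{..<ar f}. r i \<odot>\<^bsub>M\<^esub> xs ! i)"
  proof (intro bexI[of _ "coord f"] ballI)
    fix xs
    assume xs: "xs \<in> args (carrier M) (ar f)"
    \<comment> \<open>The list is padded with \<open>z\<close>, since
      \<open>oper_eq_sum_coord\<close> takes a sequence with all its terms in the carrier.\<close>
    define X where "X i = (if i < ar f then xs ! i else z)" for i
    have xs_closed: "xs ! i \<in> carrier C" if "i < ar f" for i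
      using xs that by (auto simp: args_def)
    have X: "X i \<in> carrier C" for i
      using xs_closed z_closed by (simp add: X_def)
    have "xs = map X [0..<ar f]"
      using xs by (auto simp: args_def X_def intro: nth_equalityI)
    then have "kop M f xs = (\<Oplus>\<^bsub>M\<^esub>i\<in>{..<ar f}. coord f i (X i))"
      using oper_eq_sum_coord[OF X] by simp
    also have "\<dots> = (\<Oplus>\<^bsub>M\<^esub>i\<in>{..<ar f}. coord f i \<odot>\<^bsub>M\<^esub> xs ! i)"
      using xs_closed M.End_ring_apply(1)[OF _ coord_in_End]
      by (intro M.finsum_cong') (auto simp: X_def)
    finally show "kop M f xs = (\<Oplus>\<^bsub>M\<^esub>i\<in>{..<ar f}. coord f i \<odot>\<^bsub>M\<^esub> xs ! i)" .
  qed (simp add: coord_in_End)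
next
  fix x y w
  assume "x \<in> carrier M" "y \<in> carrier M" "w \<in> carrier M"
  \<comment> \<open>The right side is \<open>d (d x y z) z w\<close> for the zero \<open>z\<close>,
    which \<open>d_assoc\<close> with \<open>v = y\<close> reduces to
    \<open>d x y w\<close>.\<close>
  then show "kop M m [x, y, w] = x \<ominus>\<^bsub>M\<^esub> y \<oplus>\<^bsub>M\<^esub> w"
    using d_assoc[of x z w y] z_closed by (simp add: M_minus mal_left)
qed

end


section \<open>Cohomologous cochains\<close>

text \<open>The relation underlying equality in \<open>H2\<close>, stated on argument lists over
  \<open>Q\<close> only. The coboundary of \<open>h\<close> stands on the left, as in the cosets
  that make up \<open>H2\<close>.\<close>

definition cohomologous ::
  "('f \<Rightarrow> nat) \<Rightarrow> ('q, 'f) ualgebra \<Rightarrow> ('r, 'a, 'f) kernel_algebra \<Rightarrow>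
   ('q, 'a, 'f) cochain \<Rightarrow> ('q, 'a, 'f) cochain \<Rightarrow> bool" where
  "cohomologous ar Q E S T \<longleftrightarrow> (\<exists>h\<in>carrier Q \<rightarrow> carrier E. \<forall>f. \<forall>qs\<in>args (carrier Q) (ar f).
     S f qs = (kop E f (map h qs) \<ominus>\<^bsub>E\<^esub> h (oper Q f qs)) \<oplus>\<^bsub>E\<^esub> T f qs)"

lemma two_cocyclesD:
  assumes "T \<in> two_cocycles ar Q B" and "qs \<in> args (carrier Q) (ar f)"
  shows "T f qs \<in> carrier B"
  using assms by (auto simp: two_cocycles_def)

context kernel_alg
begin

lemma kop_fun_closed:
  assumes "h \<in> carrier Q \<rightarrow> carrier B" and "qs \<in> args (carrier Q) (ar f)"
  shows "kop B f (map h qs) \<in> carrier B"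
  using assms by (intro kop_closed) (auto simp: args_def)

lemma cohomologous_refl:
  assumes "is_ualgebra ar Q" and "T \<in> two_cocycles ar Q B"
  shows "cohomologous ar Q B T T"
  unfolding cohomologous_def
proof (intro bexI[of _ "\<lambda>_. \<zero>\<^bsub>B\<^esub>"] allI ballI)
  fix f qs
  assume qs: "qs \<in> args (carrier Q) (ar f)"
  then have "kop B f (map (\<lambda>_. \<zero>\<^bsub>B\<^esub>) qs) = \<zero>\<^bsub>B\<^esub>"
    by (intro kop_zero) (simp add: args_def)
  then show "T f qs = (kop B f (map (\<lambda>_. \<zero>\<^bsub>B\<^esub>) qs) \<ominus>\<^bsub>B\<^esub> \<zero>\<^bsub>B\<^esub>) \<oplus>\<^bsub>B\<^esub> T f qs"
    using two_cocyclesD[OF assms(2) qs] by (simp add: M.minus_eq M.r_neg)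
qed simp

lemma cohomologous_sym:
  assumes Q: "is_ualgebra ar Q" and T: "T \<in> two_cocycles ar Q B"
    and ST: "cohomologous ar Q B S T"
  shows "cohomologous ar Q B T S"
proof -
  obtain h where h: "h \<in> carrier Q \<rightarrow> carrier B"
    and S: "\<And>f qs. qs \<in> args (carrier Q) (ar f) \<Longrightarrow>
      S f qs = (kop B f (map h qs) \<ominus>\<^bsub>B\<^esub> h (oper Q f qs)) \<oplus>\<^bsub>B\<^esub> T f qs"
    using ST by (auto simp: cohomologous_def)
  \<comment> \<open>The witness is the negative of \<open>h\<close>, written as
    \<open>0 - h q\<close> so that \<open>kop_minus\<close> and \<open>kop_zero\<close>
    apply.\<close>
  show ?thesis
    unfolding cohomologous_def
  proof (intro bexI[of _ "\<lambda>q. \<zero>\<^bsub>B\<^esub> \<ominus>\<^bsub>B\<^esub> h q"] allI ballI)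
    fix f qs
    assume qs: "qs \<in> args (carrier Q) (ar f)"
    have "kop B f (map (\<lambda>q. \<zero>\<^bsub>B\<^esub> \<ominus>\<^bsub>B\<^esub> h q) qs) = \<zero>\<^bsub>B\<^esub> \<ominus>\<^bsub>B\<^esub> kop B f (map h qs)"
      using qs h by (subst kop_minus) (auto simp: args_def kop_zero)
    moreover have "h (oper Q f qs) \<in> carrier B"
      using Q qs h by (auto simp: is_ualgebra_def)
    ultimately show "T f qs = (kop B f (map (\<lambda>q. \<zero>\<^bsub>B\<^esub> \<ominus>\<^bsub>B\<^esub> h q) qs) \<ominus>\<^bsub>B\<^esub>
        (\<zero>\<^bsub>B\<^esub> \<ominus>\<^bsub>B\<^esub> h (oper Q f qs))) \<oplus>\<^bsub>B\<^esub> S f qs"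
      using S[OF qs] two_cocyclesD[OF T qs] kop_fun_closed[OF h qs]
      by (simp add: M.minus_eq M.minus_add M.a_ac M.r_neg M.r_neg1 M.r_neg2)
  qed (use h in auto)
qed

lemma cohomologous_trans:
  assumes Q: "is_ualgebra ar Q" and U: "U \<in> two_cocycles ar Q B"
    and ST: "cohomologous ar Q B S T" and TU: "cohomologous ar Q B T U"
  shows "cohomologous ar Q B S U"
proof -
  obtain h where h: "h \<in> carrier Q \<rightarrow> carrier B"
    and S: "\<And>f qs. qs \<in> args (carrier Q) (ar f) \<Longrightarrow>
      S f qs = (kop B f (map h qs) \<ominus>\<^bsub>B\<^esub> h (oper Q f qs)) \<oplus>\<^bsub>B\<^esub> T f qs"
    using ST by (auto simp: cohomologous_def)
  obtain k where k: "k \<in> carrier Q \<rightarrow> carrier B"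
    and T: "\<And>f qs. qs \<in> args (carrier Q) (ar f) \<Longrightarrow>
      T f qs = (kop B f (map k qs) \<ominus>\<^bsub>B\<^esub> k (oper Q f qs)) \<oplus>\<^bsub>B\<^esub> U f qs"
    using TU by (auto simp: cohomologous_def)
  show ?thesis
    unfolding cohomologous_def
  proof (intro bexI[of _ "\<lambda>q. h q \<oplus>\<^bsub>B\<^esub> k q"] allI ballI)
    fix f qs
    assume qs: "qs \<in> args (carrier Q) (ar f)"
    have "kop B f (map (\<lambda>q. h q \<oplus>\<^bsub>B\<^esub> k q) qs) = kop B f (map h qs) \<oplus>\<^bsub>B\<^esub> kop B f (map k qs)"
      using qs h k by (intro kop_add) (auto simp: args_def)
    moreover have "h (oper Q f qs) \<in> carrier B" "k (oper Q f qs) \<in> carrier B"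
      using Q qs h k by (auto simp: is_ualgebra_def)
    ultimately show "S f qs = (kop B f (map (\<lambda>q. h q \<oplus>\<^bsub>B\<^esub> k q) qs) \<ominus>\<^bsub>B\<^esub>
        (h (oper Q f qs) \<oplus>\<^bsub>B\<^esub> k (oper Q f qs))) \<oplus>\<^bsub>B\<^esub> U f qs"
      using S[OF qs] T[OF qs] two_cocyclesD[OF U qs] kop_fun_closed[OF h qs] kop_fun_closed[OF k qs]
      by (simp add: M.minus_eq M.minus_add M.a_ac)
  qed (use h k in auto)
qed

text \<open>Unfolds the coset element by element, so that equality of cohomology classes reduces to
  the equivalence relation \<open>cohomologous\<close>.\<close>

lemma H2_class_eq_cohomologous:
  assumes Q: "is_ualgebra ar Q" and T: "T \<in> two_cocycles ar Q B"
  shows "H2_class ar \<U> Q B T = {S \<in> two_cocycles ar Q B. cohomologous ar Q B S T}"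
proof (rule antisym; rule subsetI)
  fix S
  assume "S \<in> H2_class ar \<U> Q B T"
  then obtain h where h: "h \<in> carrier Q \<rightarrow> carrier B"
    and S: "S = (\<lambda>f. \<lambda>qs\<in>args (carrier Q) (ar f).
      (kop B f (map h qs) \<ominus>\<^bsub>B\<^esub> h (oper Q f qs)) \<oplus>\<^bsub>B\<^esub> T f qs)"
    by (auto simp: H2_class_def r_coset_def Z2_def two_coboundaries_def cong: restrict_cong)
  have "h (oper Q f qs) \<in> carrier B" if "qs \<in> args (carrier Q) (ar f)" for f qs
    using Q h that by (auto simp: is_ualgebra_def)
  then have "S \<in> two_cocycles ar Q B"
    using kop_fun_closed[OF h] two_cocyclesD[OF T] by (auto simp: S two_cocycles_def)
  then show "S \<in> {S \<in> two_cocycles ar Q B. cohomologous ar Q B S T}"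
    using h by (auto simp: S cohomologous_def)
next
  fix S
  assume "S \<in> {S \<in> two_cocycles ar Q B. cohomologous ar Q B S T}"
  then obtain h where h: "h \<in> carrier Q \<rightarrow> carrier B" and S: "S \<in> two_cocycles ar Q B"
    and eq: "\<And>f qs. qs \<in> args (carrier Q) (ar f) \<Longrightarrow>
      S f qs = (kop B f (map h qs) \<ominus>\<^bsub>B\<^esub> h (oper Q f qs)) \<oplus>\<^bsub>B\<^esub> T f qs"
    by (auto simp: cohomologous_def)
  let ?G = "\<lambda>f. \<lambda>qs\<in>args (carrier Q) (ar f). kop B f (map h qs) \<ominus>\<^bsub>B\<^esub> h (oper Q f qs)"
  have "?G \<in> two_coboundaries ar Q B"
    using h by (auto simp: two_coboundaries_def)
  moreover have "S = ?G \<otimes>\<^bsub>Z2 ar \<U> Q B\<^esub> T"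
  proof (intro ext)
    fix f qs
    \<comment> \<open>Both sides are extensional, so they also agree on lists that are not argument
      lists over \<open>Q\<close>.\<close>
    show "S f qs = (?G \<otimes>\<^bsub>Z2 ar \<U> Q B\<^esub> T) f qs"
      using S eq by (auto simp: Z2_def two_cocycles_def PiE_iff extensional_def)
  qed
  ultimately show "S \<in> H2_class ar \<U> Q B T"
    unfolding H2_class_def r_coset_def by blast
qed

lemma H2_class_eq_iff:
  assumes "is_ualgebra ar Q" and "S \<in> two_cocycles ar Q B" and "T \<in> two_cocycles ar Q B"
  shows "H2_class ar \<U> Q B S = H2_class ar \<U> Q B T \<longleftrightarrow> cohomologous ar Q B S T"
proof
  assume "H2_class ar \<U> Q B S = H2_class ar \<U> Q B T"
  moreover have "S \<in> H2_class ar \<U> Q B S"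
    using assms by (simp add: H2_class_eq_cohomologous cohomologous_refl)
  ultimately show "cohomologous ar Q B S T"
    using assms by (simp add: H2_class_eq_cohomologous)
next
  assume ST: "cohomologous ar Q B S T"
  have "cohomologous ar Q B U S \<longleftrightarrow> cohomologous ar Q B U T" for U
    using cohomologous_trans[OF assms(1,3) _ ST]
      cohomologous_trans[OF assms(1,2) _ cohomologous_sym[OF assms(1,3) ST]] by blast
  then show "H2_class ar \<U> Q B S = H2_class ar \<U> Q B T"
    using assms by (simp add: H2_class_eq_cohomologous)
qed

end


section \<open>Homomorphisms from an extension to a kernel algebra\<close>

lemma (in abelian_group) uminus_zero: "\<ominus> \<zero> = \<zero>"
  by (rule minus_equality) simp_all

text \<open>Addition is expressible through \<open>m\<close> and zero as
  \<open>x + y = m(x, 0, y)\<close>, and members of \<open>Hom\<close> preserve both.\<close>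

lemma Hom_add:
  assumes "is_kernel_algebra ar m R B" and "is_kernel_algebra ar m S E" and "ar m = 3"
    and \<phi>: "\<phi> \<in> carrier (Hom ar B E)" and "x \<in> carrier B" "y \<in> carrier B"
  shows "\<phi> (x \<oplus>\<^bsub>B\<^esub> y) = \<phi> x \<oplus>\<^bsub>E\<^esub> \<phi> y"
proof -
  interpret B: kernel_alg ar m R B by unfold_locales fact
  interpret E: kernel_alg ar m S E by unfold_locales fact
  have hom: "is_hom ar (alg B) (alg E) \<phi>" and zero: "\<phi> \<zero>\<^bsub>B\<^esub> = \<zero>\<^bsub>E\<^esub>"
    using \<phi> by (auto simp: Hom_def)
  have "[x, \<zero>\<^bsub>B\<^esub>, y] \<in> args (carrier (alg B)) (ar m)"
    using assms by (simp add: args_def alg_def)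
  then have "\<phi> (kop B m [x, \<zero>\<^bsub>B\<^esub>, y]) = kop E m [\<phi> x, \<phi> \<zero>\<^bsub>B\<^esub>, \<phi> y]"
    using is_homD(2)[OF hom] by (simp add: alg_def)
  moreover have "\<phi> x \<in> carrier E" "\<phi> y \<in> carrier E"
    using is_homD(1)[OF hom] assms by (simp_all add: alg_def)
  ultimately show ?thesis
    using assms zero by (simp add: B.kop_difference E.kop_difference B.M.minus_eq E.M.minus_eq
        B.M.uminus_zero E.M.uminus_zero)
qed

lemma HomD:
  assumes "\<phi> \<in> carrier (Hom ar B E)"
  shows "x \<in> carrier B \<Longrightarrow> \<phi> x \<in> carrier E"
    and "xs \<in> args (carrier B) (ar f) \<Longrightarrow> \<phi> (kop B f xs) = kop E f (map \<phi> xs)"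
    and "\<phi> \<zero>\<^bsub>B\<^esub> = \<zero>\<^bsub>E\<^esub>"
  using assms by (auto simp: Hom_def is_hom_def alg_def)

text \<open>Bookkeeping for \<open>cohomologous_imp_hom\<close>: there \<open>y\<close> is the value
  of \<open>\<chi>\<close> on the cocycle and \<open>v\<close> the value of \<open>h\<close> on the
  result in \<open>Q\<close>; both drop out.\<close>

lemma (in abelian_group) cancel_right:
  assumes "x \<in> carrier G" "y \<in> carrier G" "z \<in> carrier G" "v \<in> carrier G" "w \<in> carrier G"
  shows "(x \<oplus> ((w \<ominus> v) \<oplus> y)) \<ominus> (z \<oplus> y) \<oplus> v = (x \<ominus> z) \<oplus> w"
proof -
  have "(a \<oplus> y) \<ominus> (z \<oplus> y) = a \<ominus> z" if "a \<in> carrier G" for a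
    using that assms by (simp add: minus_eq minus_add a_assoc a_comm[of "\<ominus> z" "\<ominus> y"] r_neg2 r_neg1)
  moreover have "x \<oplus> ((w \<ominus> v) \<oplus> y) = (x \<oplus> (w \<ominus> v)) \<oplus> y"
    using assms by (simp add: a_assoc)
  moreover have "(x \<oplus> (w \<ominus> v)) \<ominus> z = ((x \<ominus> z) \<oplus> w) \<ominus> v"
    using assms by (simp add: minus_eq a_ac)
  moreover have "(a \<ominus> v) \<oplus> v = a" if "a \<in> carrier G" for a
    using that assms by (simp add: minus_eq a_assoc l_neg)
  ultimately show ?thesis
    using assms by simp
qed

locale extension_cocycle =
  B: kernel_alg ar m R B + E: kernel_alg ar m S E
  for ar :: "'f \<Rightarrow> nat" and m :: 'f
    and R :: "'r ring" and B :: "('r, 'a, 'f) kernel_algebra"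
    and S :: "'s ring" and E :: "('s, 'b, 'f) kernel_algebra" +
  fixes Q :: "('q, 'f) ualgebra" and T :: "('q, 'a, 'f) cochain"
  assumes arity: "ar m = 3" and ualgebra_Q: "is_ualgebra ar Q"
    and cocycle: "T \<in> two_cocycles ar Q B"
begin

abbreviation push :: "('a \<Rightarrow> 'b) \<Rightarrow> ('q, 'b, 'f) cochain" where
  "push \<phi> \<equiv> \<lambda>f. \<lambda>qs\<in>args (carrier Q) (ar f). \<phi> (T f qs)"

lemma push_cocycle: "\<phi> \<in> carrier (Hom ar B E) \<Longrightarrow> push \<phi> \<in> two_cocycles ar Q E"
  using HomD(1)[of \<phi> ar B E] two_cocyclesD[OF cocycle] by (auto simp: two_cocycles_def)

lemma transgression_eq_iff:
  assumes "\<phi> \<in> carrier (Hom ar B E)" and "\<chi> \<in> carrier (Hom ar B E)"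
  shows "transgression ar \<U> Q E T \<phi> = transgression ar \<U> Q E T \<chi> \<longleftrightarrow>
    cohomologous ar Q E (push \<phi>) (push \<chi>)"
  unfolding transgression_def
  by (rule E.H2_class_eq_iff[OF ualgebra_Q push_cocycle push_cocycle]) fact+

lemma tensor_args:
  assumes "ps \<in> args (carrier (tensor_alg B T Q)) n"
  shows "map fst ps \<in> args (carrier B) n" and "map snd ps \<in> args (carrier Q) n"
  using assms by (auto simp: args_def tensor_alg_def)

text \<open>The cocycle contributes \<open>(\<phi> - \<chi>)(T f qs)\<close> to the value at a
  result of \<open>f\<close>; this is exactly the amount by which \<open>h\<close> fails to be a
  homomorphism.\<close>

lemma cohomologous_imp_hom:
  assumes \<phi>: "\<phi> \<in> carrier (Hom ar B E)" and \<chi>: "\<chi> \<in> carrier (Hom ar B E)"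
    and "cohomologous ar Q E (push \<phi>) (push \<chi>)"
  obtains h where "h \<in> carrier Q \<rightarrow> carrier E"
    and "is_hom ar (tensor_alg B T Q) (alg E) (\<lambda>(b, q). (\<phi> b \<ominus>\<^bsub>E\<^esub> \<chi> b) \<oplus>\<^bsub>E\<^esub> h q)"
proof -
  obtain h where h: "h \<in> carrier Q \<rightarrow> carrier E"
    and eq: "\<And>f qs. qs \<in> args (carrier Q) (ar f) \<Longrightarrow>
      \<phi> (T f qs) = (kop E f (map h qs) \<ominus>\<^bsub>E\<^esub> h (oper Q f qs)) \<oplus>\<^bsub>E\<^esub> \<chi> (T f qs)"
    using assms(3) by (auto simp: cohomologous_def)
  let ?g = "\<lambda>(b, q). (\<phi> b \<ominus>\<^bsub>E\<^esub> \<chi> b) \<oplus>\<^bsub>E\<^esub> h q"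
  have "?g (oper (tensor_alg B T Q) f ps) = oper (alg E) f (map ?g ps)"
    if ps: "ps \<in> args (carrier (tensor_alg B T Q)) (ar f)" for f ps
  proof -
    let ?bs = "map fst ps" and ?qs = "map snd ps"
    note bs = tensor_args(1)[OF ps] and qs = tensor_args(2)[OF ps]
    have len: "length ps = ar f"
      using ps by (simp add: args_def)
    have closed: "fst x \<in> carrier B" "snd x \<in> carrier Q" if "x \<in> set ps" for x
      using ps that by (auto simp: args_def tensor_alg_def)
    have "oper (alg E) f (map ?g ps) =
        kop E f (map (\<lambda>x. (\<phi> (fst x) \<ominus>\<^bsub>E\<^esub> \<chi> (fst x)) \<oplus>\<^bsub>E\<^esub> h (snd x)) ps)"
      by (simp only: alg_def case_prod_beta' ualgebra.select_convs)
    also have "\<dots> =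
        (kop E f (map (\<lambda>x. \<phi> (fst x)) ps) \<ominus>\<^bsub>E\<^esub> kop E f (map (\<lambda>x. \<chi> (fst x)) ps)) \<oplus>\<^bsub>E\<^esub>
        kop E f (map (\<lambda>x. h (snd x)) ps)"
      using len closed HomD(1)[OF \<phi>] HomD(1)[OF \<chi>] h
      by (subst E.kop_add) (auto simp: E.kop_minus)
    finally have rhs: "oper (alg E) f (map ?g ps) =
        (kop E f (map (\<lambda>x. \<phi> (fst x)) ps) \<ominus>\<^bsub>E\<^esub> kop E f (map (\<lambda>x. \<chi> (fst x)) ps)) \<oplus>\<^bsub>E\<^esub>
        kop E f (map (\<lambda>x. h (snd x)) ps)" .
    have "\<phi> (kop B f ?bs) = kop E f (map (\<lambda>x. \<phi> (fst x)) ps)"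
      "\<chi> (kop B f ?bs) = kop E f (map (\<lambda>x. \<chi> (fst x)) ps)"
      using HomD(2)[OF \<phi> bs] HomD(2)[OF \<chi> bs] by (simp_all add: comp_def)
    moreover have "\<phi> (T f ?qs) =
        (kop E f (map (\<lambda>x. h (snd x)) ps) \<ominus>\<^bsub>E\<^esub> h (oper Q f ?qs)) \<oplus>\<^bsub>E\<^esub> \<chi> (T f ?qs)"
      using eq[OF qs] by (simp add: comp_def)
    moreover have "kop B f ?bs \<in> carrier B" "T f ?qs \<in> carrier B"
      using B.kop_closed[OF bs] two_cocyclesD[OF cocycle qs] .
    moreover have "kop E f (map (\<lambda>x. \<phi> (fst x)) ps) \<in> carrier E"
      "kop E f (map (\<lambda>x. \<chi> (fst x)) ps) \<in> carrier E"
      "kop E f (map (\<lambda>x. h (snd x)) ps) \<in> carrier E"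
      using len closed HomD(1)[OF \<phi>] HomD(1)[OF \<chi>] h by (auto intro!: E.kop_map_closed)
    moreover have "h (oper Q f ?qs) \<in> carrier E"
      using h qs ualgebra_Q by (auto simp: is_ualgebra_def)
    ultimately show ?thesis
      unfolding rhs using HomD(1)[OF \<chi>]
      by (simp add: tensor_alg_def E.M.cancel_right Hom_add[OF B.kernel_algebra E.kernel_algebra arity \<phi>]
          Hom_add[OF B.kernel_algebra E.kernel_algebra arity \<chi>])
  qed
  then have "is_hom ar (tensor_alg B T Q) (alg E) ?g"
    using HomD(1)[OF \<phi>] HomD(1)[OF \<chi>] h by (auto simp: is_hom_def tensor_alg_def alg_def)
  with h that show ?thesis
    by blast
qed

text \<open>The zero of \<open>Hom\<close>, against which injectivity is tested in part (2). It
  commutes with the operations because module terms vanish at zero.\<close>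

lemma const_zero_in_Hom: "(\<lambda>x\<in>carrier B. \<zero>\<^bsub>E\<^esub>) \<in> carrier (Hom ar B E)"
proof -
  have "kop E f (map (\<lambda>x\<in>carrier B. \<zero>\<^bsub>E\<^esub>) xs) = \<zero>\<^bsub>E\<^esub>" if "xs \<in> args (carrier B) (ar f)" for f xs
  proof -
    have "map (\<lambda>x\<in>carrier B. \<zero>\<^bsub>E\<^esub>) xs = map (\<lambda>_. \<zero>\<^bsub>E\<^esub>) xs"
      using that by (auto simp: args_def)
    then show ?thesis
      using that E.kop_zero[of xs f] by (simp only: args_def mem_Collect_eq)
  qed
  then show ?thesis
    using B.kop_closed by (auto simp: Hom_def is_hom_def alg_def)
qed

text \<open>The fibre over the idempotent \<open>q0\<close> is a copy of \<open>B\<close>, and \<open>d((b + b0, q0), (b0, q0), (0, q))\<close>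
  equals \<open>(b, q)\<close>; so \<open>g\<close> is determined by its restriction \<open>\<theta>\<close> to this fibre and by
  the function \<open>q \<mapsto> g (0, q)\<close>, which cobounds \<open>\<theta> \<circ> T\<close>.\<close>

lemma hom_imp_cohomologous:
  assumes g: "is_hom ar (tensor_alg B T Q) (alg E) g"
    and idem: "idempotent_element ar (tensor_alg B T Q) (b0, q0)"
    and Q_mal: "\<And>q q'. q \<in> carrier Q \<Longrightarrow> q' \<in> carrier Q \<Longrightarrow> oper Q m [q, q, q'] = q'"
    and T_mal: "\<And>q q'. q \<in> carrier Q \<Longrightarrow> q' \<in> carrier Q \<Longrightarrow> T m [q, q, q'] = \<zero>\<^bsub>B\<^esub>"
  obtains \<theta> where "\<theta> \<in> carrier (Hom ar B E)"
    and "cohomologous ar Q E (push \<theta>) (push (\<lambda>x\<in>carrier B. \<zero>\<^bsub>E\<^esub>))"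
    and "\<And>b q. b \<in> carrier B \<Longrightarrow> q \<in> carrier Q \<Longrightarrow> g (b, q) = \<theta> b \<oplus>\<^bsub>E\<^esub> g (\<zero>\<^bsub>B\<^esub>, q)"
proof -
  let ?P = "tensor_alg B T Q"
  have b0: "b0 \<in> carrier B" and q0: "q0 \<in> carrier Q"
    using idem by (auto simp: idempotent_element_def tensor_alg_def)
  \<comment> \<open>The two coordinates of idempotence, with constant maps in place of
    \<open>replicate\<close> so that they rewrite the lists arising below.\<close>
  have idem_B: "kop B f (map (\<lambda>_. b0) xs) \<oplus>\<^bsub>B\<^esub> T f (map (\<lambda>_. q0) xs) = b0"
    and idem_Q: "oper Q f (map (\<lambda>_. q0) xs) = q0"
    if "length xs = ar f" for f and xs :: "'a list"
    using idem that by (auto simp: idempotent_element_def tensor_alg_def map_replicate_const)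
  have g_closed: "g (b, q) \<in> carrier E" if "b \<in> carrier B" "q \<in> carrier Q" for b q
    using is_homD(1)[OF g] that by (simp add: tensor_alg_def alg_def)
  have g_oper: "g (kop B f (map fst ps) \<oplus>\<^bsub>B\<^esub> T f (map snd ps), oper Q f (map snd ps)) =
      kop E f (map g ps)" if "ps \<in> args (carrier B \<times> carrier Q) (ar f)" for f ps
    using is_homD(2)[OF g, of ps f] that by (simp add: tensor_alg_def alg_def)
  \<comment> \<open>Shifting by \<open>b0\<close> puts the idempotent element at \<open>0\<close>,
    and subtracting its image makes \<open>\<theta>\<close> preserve \<open>0\<close>.\<close>
  define \<theta> where "\<theta> = (\<lambda>b\<in>carrier B. g (b \<oplus>\<^bsub>B\<^esub> b0, q0) \<ominus>\<^bsub>E\<^esub> g (b0, q0))"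
  have \<theta>_closed: "\<theta> b \<in> carrier E" if "b \<in> carrier B" for b
    using that g_closed b0 q0 by (simp add: \<theta>_def)
  \<comment> \<open>Over \<open>q0\<close> the cocycle is absorbed: \<open>f\<close> at the constant
    tuple \<open>b0\<close>, plus \<open>T f\<close> at the constant tuple \<open>q0\<close>, is
    \<open>b0\<close> again, so \<open>f\<close> acts on shifted elements as in
    \<open>B\<close>.\<close>
  have g_shift: "g (kop B f bs \<oplus>\<^bsub>B\<^esub> b0, q0) = kop E f (map (\<lambda>b. g (b \<oplus>\<^bsub>B\<^esub> b0, q0)) bs)"
    if bs: "bs \<in> args (carrier B) (ar f)" for f bs
  proof -
    let ?ps = "map (\<lambda>b. (b \<oplus>\<^bsub>B\<^esub> b0, q0)) bs"
    have len: "length bs = ar f" and bs': "set bs \<subseteq> carrier B"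
      using bs by (auto simp: args_def)
    have "?ps \<in> args (carrier B \<times> carrier Q) (ar f)"
      using len bs' b0 q0 by (auto simp: args_def)
    from g_oper[OF this]
    have "g (kop B f (map (\<lambda>b. b \<oplus>\<^bsub>B\<^esub> b0) bs) \<oplus>\<^bsub>B\<^esub> T f (map (\<lambda>_. q0) bs), q0) =
        kop E f (map (\<lambda>b. g (b \<oplus>\<^bsub>B\<^esub> b0, q0)) bs)"
      using idem_Q[OF len] by (simp add: comp_def)
    moreover have "kop B f (map (\<lambda>b. b \<oplus>\<^bsub>B\<^esub> b0) bs) = kop B f bs \<oplus>\<^bsub>B\<^esub> kop B f (map (\<lambda>_. b0) bs)"
      using B.kop_add[OF len, of "\<lambda>b. b" "\<lambda>_. b0"] bs' b0 by auto
    moreover have "T f (map (\<lambda>_. q0) bs) \<in> carrier B"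
      using two_cocyclesD[OF cocycle, of "map (\<lambda>_. q0) bs" f] len q0 by (auto simp: args_def)
    moreover have "kop B f (map (\<lambda>_. b0) bs) \<in> carrier B"
      using len b0 by (rule B.kop_map_closed)
    ultimately show ?thesis
      using idem_B[OF len] B.kop_closed[OF bs] by (simp add: B.M.a_assoc)
  qed
  have "\<theta> (kop B f bs) = kop E f (map \<theta> bs)" if bs: "bs \<in> args (carrier B) (ar f)" for f bs
  proof -
    have len: "length bs = ar f" and bs': "set bs \<subseteq> carrier B"
      using bs by (auto simp: args_def)
    \<comment> \<open>The image of the idempotent is idempotent; this is \<open>g_shift\<close> at
      the zero tuple.\<close>
    have const: "kop E f (map (\<lambda>_. g (b0, q0)) bs) = g (b0, q0)"
      using g_shift[of "map (\<lambda>_. \<zero>\<^bsub>B\<^esub>) bs" f] len b0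
      by (simp add: B.kop_zero args_def comp_def image_subset_iff)
    have "map \<theta> bs = map (\<lambda>b. g (b \<oplus>\<^bsub>B\<^esub> b0, q0) \<ominus>\<^bsub>E\<^esub> g (b0, q0)) bs"
      using bs' by (auto simp: \<theta>_def)
    then have "kop E f (map \<theta> bs) = kop E f (map (\<lambda>b. g (b \<oplus>\<^bsub>B\<^esub> b0, q0) \<ominus>\<^bsub>E\<^esub> g (b0, q0)) bs)"
      by (rule arg_cong)
    also have "\<dots> = kop E f (map (\<lambda>b. g (b \<oplus>\<^bsub>B\<^esub> b0, q0)) bs) \<ominus>\<^bsub>E\<^esub> kop E f (map (\<lambda>_. g (b0, q0)) bs)"
      using bs' b0 q0 g_closed by (intro E.kop_minus[OF len]) auto
    also have "\<dots> = \<theta> (kop B f bs)"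
      using B.kop_closed[OF bs] by (simp add: \<theta>_def const g_shift[OF bs])
    finally show ?thesis
      by simp
  qed
  then have "is_hom ar (alg B) (alg E) \<theta>"
    using \<theta>_closed by (simp add: is_hom_def alg_def)
  moreover have "\<theta> \<in> carrier B \<rightarrow>\<^sub>E carrier E"
    using \<theta>_closed by (auto simp: \<theta>_def)
  moreover have "\<theta> \<zero>\<^bsub>B\<^esub> = \<zero>\<^bsub>E\<^esub>"
    using g_closed b0 q0 by (simp add: \<theta>_def E.M.minus_eq E.M.r_neg)
  ultimately have \<theta>: "\<theta> \<in> carrier (Hom ar B E)"
    by (simp add: Hom_def)
  have g_eq: "g (b, q) = \<theta> b \<oplus>\<^bsub>E\<^esub> g (\<zero>\<^bsub>B\<^esub>, q)" if b: "b \<in> carrier B" and q: "q \<in> carrier Q" for b q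
  proof -
    have "[(b \<oplus>\<^bsub>B\<^esub> b0, q0), (b0, q0), (\<zero>\<^bsub>B\<^esub>, q)] \<in> args (carrier B \<times> carrier Q) (ar m)"
      using b q b0 q0 arity by (simp add: args_def)
    \<comment> \<open>\<open>T_mal\<close> removes the cocycle value, and \<open>Q_mal\<close> makes
      the second coordinate \<open>q\<close>.\<close>
    from g_oper[OF this] have "g (kop B m [b \<oplus>\<^bsub>B\<^esub> b0, b0, \<zero>\<^bsub>B\<^esub>], q) =
        kop E m [g (b \<oplus>\<^bsub>B\<^esub> b0, q0), g (b0, q0), g (\<zero>\<^bsub>B\<^esub>, q)]"
      using b q b0 q0 by (simp add: Q_mal T_mal B.kop_difference)
    then show ?thesis
      using b q b0 q0 g_closed
      by (simp add: B.kop_difference E.kop_difference \<theta>_def B.M.minus_eq B.M.a_assoc B.M.r_neg)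
  qed
  have "cohomologous ar Q E (push \<theta>) (push (\<lambda>x\<in>carrier B. \<zero>\<^bsub>E\<^esub>))"
    unfolding cohomologous_def
  proof (intro bexI[of _ "\<lambda>q. g (\<zero>\<^bsub>B\<^esub>, q)"] allI ballI)
    fix f qs
    assume qs: "qs \<in> args (carrier Q) (ar f)"
    \<comment> \<open>At points with first coordinate \<open>0\<close> the \<open>B\<close>-part of
      the operation vanishes, so only the cocycle value remains there.\<close>
    let ?ps = "map (\<lambda>q. (\<zero>\<^bsub>B\<^esub>, q)) qs"
    have T: "T f qs \<in> carrier B" and Q: "oper Q f qs \<in> carrier Q"
      using two_cocyclesD[OF cocycle qs] ualgebra_Q qs by (auto simp: is_ualgebra_def)
    have "?ps \<in> args (carrier B \<times> carrier Q) (ar f)"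
      using qs by (auto simp: args_def)
    from g_oper[OF this]
    have "g (T f qs, oper Q f qs) = kop E f (map (\<lambda>q. g (\<zero>\<^bsub>B\<^esub>, q)) qs)"
      using qs T B.kop_zero[of qs f] by (simp add: args_def comp_def)
    then have "kop E f (map (\<lambda>q. g (\<zero>\<^bsub>B\<^esub>, q)) qs) = \<theta> (T f qs) \<oplus>\<^bsub>E\<^esub> g (\<zero>\<^bsub>B\<^esub>, oper Q f qs)"
      using g_eq[OF T Q] by simp
    then show "push \<theta> f qs = (kop E f (map (\<lambda>q. g (\<zero>\<^bsub>B\<^esub>, q)) qs) \<ominus>\<^bsub>E\<^esub> g (\<zero>\<^bsub>B\<^esub>, oper Q f qs)) \<oplus>\<^bsub>E\<^esub>
        push (\<lambda>x\<in>carrier B. \<zero>\<^bsub>E\<^esub>) f qs"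
      using qs T Q \<theta>_closed g_closed by (simp add: E.M.minus_eq E.M.a_assoc E.M.r_neg)
  qed (use g_closed in auto)
  with \<theta> g_eq that show ?thesis
    by blast
qed

end

text \<open>Compatibility is applied to \<open>m(x,x,y) = y\<close>: the variable on the right
  contributes \<open>0\<close>, and on the left \<open>m(0,0,0) = 0\<close> leaves only the cocycle
  value.\<close>

lemma compatible_mal:
  assumes B: "is_kernel_algebra ar m R B" and T: "T \<in> two_cocycles ar Q B" and arity: "ar m = 3"
    and comp: "compatible ar \<U> Q B T"
    and id: "(Op m [Var 0, Var 0, Var 1], Var 1) \<in> identities ar \<U>"
    and q: "q \<in> carrier Q" "q' \<in> carrier Q"
  shows "T m [q, q, q'] = \<zero>\<^bsub>B\<^esub>"
proof -
  interpret B: kernel_alg ar m R B by unfold_locales fact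
  let ?\<rho> = "\<lambda>i::nat. if i = 0 then q else q'"
  have "range ?\<rho> \<subseteq> carrier Q"
    using q by auto
  then have "trm_bd Q B T ?\<rho> (Op m [Var 0, Var 0, Var 1]) = trm_bd Q B T ?\<rho> (Var 1)"
    using comp id unfolding compatible_def by blast
  moreover have "T m [q, q, q'] \<in> carrier B"
    using two_cocyclesD[OF T] q arity by (simp add: args_def)
  ultimately show ?thesis
    by (simp add: B.kop_difference B.M.minus_eq B.M.uminus_zero)
qed

lemma satisfies_mal:
  assumes sat: "satisfies A (Op m [Var 0, Var 0, Var 1]) (Var 1)"
    and x: "x \<in> carrier A" "y \<in> carrier A"
  shows "oper A m [x, x, y] = y"
proof -
  have "range (\<lambda>i::nat. if i = 0 then x else y) \<subseteq> carrier A"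
    using x by auto
  from sat[unfolded satisfies_def, rule_format, OF this] show ?thesis
    by simp
qed


section \<open>The abelianization\<close>

text \<open>The class map of \<open>[1,1]\<close>; as the \<open>\<kappa>\<close> of
  \<open>rep_alg\<close> it produces a copy of \<open>A/[1,1]\<close>.\<close>

definition abelianization :: "('f \<Rightarrow> nat) \<Rightarrow> ('a, 'f) ualgebra \<Rightarrow> 'a \<Rightarrow> 'a set" where
  "abelianization ar A x = commutator ar A (con_top A) (con_top A) `` {x}"

lemma abelianization_eq_iff:
  assumes "is_ualgebra ar A" and "x \<in> carrier A" and "y \<in> carrier A"
  shows "abelianization ar A x = abelianization ar A y \<longleftrightarrow>
    (x, y) \<in> commutator ar A (con_top A) (con_top A)"
proof -
  have "equiv (carrier A) (commutator ar A (con_top A) (con_top A))"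
    using commutator_in_Con[OF assms(1)] by (auto simp: Con_def)
  then show ?thesis
    using assms by (simp add: abelianization_def eq_equiv_class_iff)
qed

lemma abelianization_compatible:
  assumes A: "is_ualgebra ar A"
  shows "kernel_compatible ar A (abelianization ar A)"
  unfolding kernel_compatible_def
proof (intro allI ballI impI)
  fix f xs ys
  assume xs: "xs \<in> args (carrier A) (ar f)" and ys: "ys \<in> args (carrier A) (ar f)"
    and eq: "map (abelianization ar A) xs = map (abelianization ar A) ys"
  let ?\<gamma> = "commutator ar A (con_top A) (con_top A)"
  have "(xs ! i, ys ! i) \<in> ?\<gamma>" if "i < ar f" for i
  proof -
    have "abelianization ar A (xs ! i) = abelianization ar A (ys ! i)"
      using arg_cong[OF eq, of "\<lambda>zs. zs ! i"] that xs ys by (simp add: args_def)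
    moreover have "xs ! i \<in> carrier A" "ys ! i \<in> carrier A"
      using xs ys that by (auto simp: args_def)
    ultimately show ?thesis
      using abelianization_eq_iff[OF A] by simp
  qed
  moreover have "?\<gamma> \<in> Con ar A"
    using commutator_in_Con[OF A] by simp
  ultimately have "(oper A f xs, oper A f ys) \<in> ?\<gamma>"
    using xs ys by (simp add: Con_def)
  moreover have "oper A f xs \<in> carrier A" "oper A f ys \<in> carrier A"
    using A xs ys by (auto simp: is_ualgebra_def)
  ultimately show "abelianization ar A (oper A f xs) = abelianization ar A (oper A f ys)"
    using abelianization_eq_iff[OF A] by simp
qed

text \<open>Representatives serve as the universe, so that the quotient stays in the type \<open>'u\<close> over which
  the conditions defining regularity range.\<close>

lemma abelianization_abelian_malcev:
  fixes A :: "('u, 'f) ualgebra"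
  assumes var: "is_variety ar \<U>" and diff: "difference_term TYPE('u) ar \<U> m"
    and A: "in_variety ar \<U> A" and u: "idempotent_element ar A u"
  defines "r \<equiv> rep A (abelianization ar A)" and "C \<equiv> rep_alg A (abelianization ar A)"
  shows "abelian_malcev ar m C (r u)"
proof -
  let ?\<gamma> = "commutator ar A (con_top A) (con_top A)"
  have ua: "is_ualgebra ar A"
    using A by (simp add: in_variety_def)
  have r: "is_hom ar A C r"
    unfolding r_def C_def by (rule rep_alg_is_hom[OF ua abelianization_compatible[OF ua]])
  have C_sub: "x \<in> carrier A" and r_id: "r x = x" if "x \<in> carrier C" for x
    using that by (auto simp: C_def r_def rep_alg_def rep_closed rep_rep)
  have r_eq_iff: "r x = r y \<longleftrightarrow> (x, y) \<in> ?\<gamma>" if "x \<in> carrier A" "y \<in> carrier A" for x y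
    using that by (simp add: r_def rep_eq_iff abelianization_eq_iff[OF ua])
  have arity: "ar m = 3"
    and left: "(Op m [Var 0, Var 0, Var 1], Var 1) \<in> identities ar \<U>"
    using diff by (auto simp: difference_term_def)
  have in_var: "in_variety ar \<U> C"
    by (rule in_variety_image[OF var A r]) (simp add: C_def r_def rep_alg_def)
  \<comment> \<open>The difference term condition for the full congruence is the second Mal'cev law
    modulo \<open>[1,1]\<close>.\<close>
  have right: "(x, oper A m [x, y, y]) \<in> ?\<gamma>" if "x \<in> carrier A" "y \<in> carrier A" for x y
  proof -
    have "(x, y) \<in> con_top A"
      using that by (simp add: con_top_def)
    then show ?thesis
      using diff A con_top_in_Con[OF ua] unfolding difference_term_def by blast
  qed
  have oper_C: "oper C f xs = r (oper A f xs)" for f xs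
    by (simp add: C_def r_def rep_alg_def)
  show ?thesis
  proof
    show "is_ualgebra ar C"
      using in_var by (simp add: in_variety_def)
    show "ar m = 3"
      by (rule arity)
  next
    fix x y
    assume xy: "x \<in> carrier C" "y \<in> carrier C"
    then show "oper C m [x, x, y] = y"
      by (rule satisfies_mal[OF identities_satisfied[OF var in_var left]])
    have "oper A m [x, y, y] \<in> carrier A"
      using ua xy C_sub arity by (simp add: is_ualgebra_def args_def)
    then show "oper C m [x, y, y] = x"
      using right[of x y] xy C_sub r_id r_eq_iff[of x "oper A m [x, y, y]"] by (simp add: oper_C)
  next
    show "centralizes ar C (con_top C) (con_top C) Id"
      unfolding centralizes_def
    proof (intro allI impI)
      fix t :: "('f, nat + nat) trm" and a b v w :: "nat \<Rightarrow> 'u"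
      assume t: "wf_trm ar t" and ab: "\<forall>i. (a i, b i) \<in> con_top C"
        and vw: "\<forall>j. (v j, w j) \<in> con_top C"
        and eq: "(eval C (case_sum a v) t, eval C (case_sum a w) t) \<in> Id"
      have range: "range (case_sum c d) \<subseteq> carrier C" if "c = a \<or> c = b" "d = v \<or> d = w" for c d
        using that ab vw by (auto simp: con_top_def split: sum.split)
      have range_A: "range (case_sum c d) \<subseteq> carrier A" if "c = a \<or> c = b" "d = v \<or> d = w" for c d
        using range[OF that] C_sub by blast
      \<comment> \<open>Elements of \<open>C\<close> are themselves elements of \<open>A\<close>, so
        evaluation in \<open>C\<close> is evaluation in \<open>A\<close> followed by
        \<open>r\<close>, and equality in \<open>C\<close> becomes membership in
        \<open>[1,1]\<close>.\<close>
      have eval: "eval C (case_sum c d) t = r (eval A (case_sum c d) t)"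
        if "c = a \<or> c = b" "d = v \<or> d = w" for c d
      proof -
        have "r \<circ> case_sum c d = case_sum c d"
          using range[OF that] r_id by (auto simp: fun_eq_iff image_subset_iff)
        then show ?thesis
          using eval_hom[OF ua r t range_A[OF that]] by simp
      qed
      have closed: "eval A (case_sum c d) t \<in> carrier A" if "c = a \<or> c = b" "d = v \<or> d = w" for c d
        using range_A[OF that] by (rule eval_closed[OF ua t])
      have "(eval A (case_sum a v) t, eval A (case_sum a w) t) \<in> ?\<gamma>"
        using eq closed by (simp add: eval r_eq_iff)
      moreover have "\<forall>i. (a i, b i) \<in> con_top A" "\<forall>j. (v j, w j) \<in> con_top A"
        using ab vw C_sub by (auto simp: con_top_def)
      ultimately have "(eval A (case_sum b v) t, eval A (case_sum b w) t) \<in> ?\<gamma>"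
        using commutator_centralized[of ar A "con_top A" "con_top A"] t
        unfolding centralizes_def by blast
      then show "(eval C (case_sum b v) t, eval C (case_sum b w) t) \<in> Id"
        using closed by (simp add: eval r_eq_iff)
    qed
  next
    have "u \<in> carrier A" and idem: "\<And>f. oper A f (replicate (ar f) u) = u"
      using u by (auto simp: idempotent_element_def)
    moreover have "oper C f (replicate (ar f) (r u)) = r u" for f
    proof -
      have "replicate (ar f) u \<in> args (carrier A) (ar f)"
        using \<open>u \<in> carrier A\<close> by (auto simp: args_def)
      from is_homD(2)[OF r this] show ?thesis
        using idem by simp
    qed
    ultimately show "idempotent_element ar C (r u)"
      using is_homD(1)[OF r] by (simp add: idempotent_element_def)
  qed
qed

text \<open>(RD2) is used for the affine quotient of \<open>A\<close> with equality as the
  congruence; the homomorphism found there is composed with the projection.\<close>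

lemma regular_separates:
  fixes A :: "('u, 'f) ualgebra" and E :: "('s, 'u, 'f) kernel_algebra"
  assumes var: "is_variety ar \<U>" and diff: "difference_term TYPE('u) ar \<U> m"
    and A: "in_variety ar \<U> A" and u: "idempotent_element ar A u"
    and reg: "RD2 ar \<U> m E"
    and xy: "x \<in> carrier A" "y \<in> carrier A"
    and sep: "(x, y) \<notin> commutator ar A (con_top A) (con_top A)"
  obtains g where "is_hom ar A (alg E) g" and "g x \<noteq> g y"
proof -
  let ?r = "rep A (abelianization ar A)" and ?C = "rep_alg A (abelianization ar A)"
  have ua: "is_ualgebra ar A"
    using A by (simp add: in_variety_def)
  interpret C: abelian_malcev ar m ?C "?r u"
    by (rule abelianization_abelian_malcev[OF var diff A u])
  have r: "is_hom ar A ?C ?r"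
    by (rule rep_alg_is_hom[OF ua abelianization_compatible[OF ua]])
  have in_var: "in_variety ar \<U> (alg C.M)"
    unfolding C.alg_M by (rule in_variety_image[OF var A r]) (simp add: rep_alg_def)
  have distinct: "(?r x, ?r y) \<notin> Id_on (carrier ?C)"
    using sep xy by (simp add: Id_on_iff rep_eq_iff abelianization_eq_iff[OF ua])
  have least: "Id_on (carrier ?C) \<in> Con ar (alg C.M)"
  proof -
    have "(oper ?C f xs, oper ?C f ys) \<in> Id_on (carrier ?C)"
      if xs: "xs \<in> args (carrier ?C) (ar f)" and ys: "ys \<in> args (carrier ?C) (ar f)"
        and "\<forall>i<ar f. (xs ! i, ys ! i) \<in> Id_on (carrier ?C)" for f xs ys
    proof -
      have "xs = ys"
        using that by (auto simp: args_def Id_on_iff intro!: nth_equalityI)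
      then show ?thesis
        using xs C.ualgebra by (auto simp: is_ualgebra_def)
    qed
    moreover have "equiv (carrier ?C) (Id_on (carrier ?C))"
      by (rule equivI) (auto simp: refl_on_def sym_def trans_def)
    ultimately show ?thesis
      by (simp add: Con_def C.alg_M)
  qed
  have closed: "?r x \<in> carrier ?C" "?r y \<in> carrier ?C"
    using xy is_homD(1)[OF r] by auto
  then have "?r x \<in> carrier C.M" "?r y \<in> carrier C.M"
    by simp_all
  from reg[unfolded RD2_def, rule_format, OF C.is_kernel_algebra_M in_var least this distinct]
  obtain \<chi> where \<chi>: "is_hom ar (alg C.M) (alg E) \<chi>"
    and "(?r x, ?r y) \<notin> ker_of (alg C.M) \<chi>"
    by blast
  then have "\<chi> (?r x) \<noteq> \<chi> (?r y)"
    using closed by (simp add: ker_of_def C.alg_M)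
  then show ?thesis
    using that[OF is_hom_compose[OF r \<chi>[unfolded C.alg_M]]] by simp
qed

theorem proposition5p19:
  fixes ar :: "'f \<Rightarrow> nat" and \<U> :: "'f eqns" and m :: 'f
    and Q A :: "('u, 'f) ualgebra"
    and R :: "'r ring" and B :: "('r, 'u, 'f) kernel_algebra"
    and S :: "'s ring" and E :: "('s, 'u, 'f) kernel_algebra"
    and p :: "'u \<Rightarrow> 'u" and T :: "('u, 'u, 'f) cochain"
  assumes "is_variety ar \<U>"
    and "difference_term TYPE('u) ar \<U> m"
    and "central_datum ar \<U> m Q R B"
    and "in_variety ar \<U> A"
    and "is_extension ar A Q p"
    and "represented_by ar \<U> Q B A p T"
    and "regular_kernel_algebra ar \<U> m S E"
  shows "(ker_of A p \<subseteq> commutator ar A (con_top A) (con_top A) \<longrightarrow>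
            inj_on (transgression ar \<U> Q E T) (carrier (Hom ar B E))) \<and>
         ((\<exists>u. idempotent_element ar A u) \<and>
          inj_on (transgression ar \<U> Q E T) (carrier (Hom ar B E)) \<longrightarrow>
            ker_of A p \<subseteq> commutator ar A (con_top A) (con_top A))"
proof -
  have B: "is_kernel_algebra ar m R B" and Q: "in_variety ar \<U> Q" and A: "is_ualgebra ar A"
    and E: "is_kernel_algebra ar m S E" and RD2: "RD2 ar \<U> m E"
    using assms(3,4,7) by (auto simp: central_datum_def in_variety_def regular_kernel_algebra_def)
  have arity: "ar m = 3" and mal: "(Op m [Var 0, Var 0, Var 1], Var 1) \<in> identities ar \<U>"
    using assms(2) by (auto simp: difference_term_def)
  obtain \<psi> where T: "T \<in> two_cocycles ar Q B" and comp: "compatible ar \<U> Q B T"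
    and \<psi>: "is_iso ar A (tensor_alg B T Q) \<psi>" and p: "\<And>x. x \<in> carrier A \<Longrightarrow> snd (\<psi> x) = p x"
    using assms(6) by (auto simp: represented_by_def Z2_def)
  interpret extension_cocycle ar m R B S E Q T
    using B E arity Q T by unfold_locales (auto simp: in_variety_def)
  let ?P = "tensor_alg B T Q" and ?\<gamma> = "commutator ar A (con_top A) (con_top A)"
  have hom_\<psi>: "is_hom ar A ?P \<psi>" and bij: "bij_betw \<psi> (carrier A) (carrier ?P)"
    using \<psi> by (auto simp: is_iso_def)
  show ?thesis
  proof (intro conjI impI)
    assume le: "ker_of A p \<subseteq> ?\<gamma>"
    show "inj_on (transgression ar \<U> Q E T) (carrier (Hom ar B E))"
    proof (rule inj_onI)
      fix \<phi> \<chi>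
      assume \<phi>: "\<phi> \<in> carrier (Hom ar B E)" and \<chi>: "\<chi> \<in> carrier (Hom ar B E)"
        and "transgression ar \<U> Q E T \<phi> = transgression ar \<U> Q E T \<chi>"
      then have coh: "cohomologous ar Q E (push \<phi>) (push \<chi>)"
        by (simp only: transgression_eq_iff)
      obtain h where h: "h \<in> carrier Q \<rightarrow> carrier E"
        and g: "is_hom ar ?P (alg E) (\<lambda>(b, q). (\<phi> b \<ominus>\<^bsub>E\<^esub> \<chi> b) \<oplus>\<^bsub>E\<^esub> h q)"
        by (rule cohomologous_imp_hom[OF \<phi> \<chi> coh])
      let ?g = "\<lambda>(b, q). (\<phi> b \<ominus>\<^bsub>E\<^esub> \<chi> b) \<oplus>\<^bsub>E\<^esub> h q"
      have ker: "?\<gamma> \<subseteq> ker_of A (?g \<circ> \<psi>)"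
        by (rule E.commutator_le_kernel[OF A is_hom_compose[OF hom_\<psi> g]])
      obtain q where q: "q \<in> carrier Q"
        using ualgebra_Q by (auto simp: is_ualgebra_def)
      have "\<phi> b = \<chi> b" if b: "b \<in> carrier B" for b
      proof -
        \<comment> \<open>Points over the same \<open>q\<close> form a pair in the kernel of
          \<open>p\<close>; comparing \<open>b\<close> with \<open>0\<close> makes the common term
          \<open>h q\<close> cancel.\<close>
        have "(b, q) \<in> \<psi> ` carrier A" "(\<zero>\<^bsub>B\<^esub>, q) \<in> \<psi> ` carrier A"
          using bij b q by (auto simp: bij_betw_def tensor_alg_def)
        then obtain x y where x: "x \<in> carrier A" "\<psi> x = (b, q)"
          and y: "y \<in> carrier A" "\<psi> y = (\<zero>\<^bsub>B\<^esub>, q)"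
          by (metis imageE)
        then have "(x, y) \<in> ker_of A p"
          using p[of x] p[of y] by (simp add: ker_of_def)
        then have "(x, y) \<in> ker_of A (?g \<circ> \<psi>)"
          using le ker by blast
        then have "?g (b, q) = ?g (\<zero>\<^bsub>B\<^esub>, q)"
          using x y by (simp add: ker_of_def)
        moreover have "\<phi> b \<in> carrier E" "\<chi> b \<in> carrier E" "h q \<in> carrier E"
          using HomD(1)[OF \<phi>] HomD(1)[OF \<chi>] h b q by auto
        ultimately have "\<phi> b \<ominus>\<^bsub>E\<^esub> \<chi> b = \<zero>\<^bsub>E\<^esub>"
          using HomD(3)[OF \<phi>] HomD(3)[OF \<chi>] by (simp add: E.M.minus_eq E.M.r_neg)
        moreover have "\<phi> b = (\<phi> b \<ominus>\<^bsub>E\<^esub> \<chi> b) \<oplus>\<^bsub>E\<^esub> \<chi> b"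
          using \<open>\<phi> b \<in> carrier E\<close> \<open>\<chi> b \<in> carrier E\<close>
          by (simp add: E.M.minus_eq E.M.a_assoc E.M.l_neg)
        ultimately show ?thesis
          using \<open>\<chi> b \<in> carrier E\<close> by simp
      qed
      then show "\<phi> = \<chi>"
        using \<phi> \<chi> by (auto simp: Hom_def intro: PiE_ext)
    qed
  next
    assume "(\<exists>u. idempotent_element ar A u) \<and>
      inj_on (transgression ar \<U> Q E T) (carrier (Hom ar B E))"
    then obtain u where u: "idempotent_element ar A u"
      and inj: "inj_on (transgression ar \<U> Q E T) (carrier (Hom ar B E))"
      by blast
    show "ker_of A p \<subseteq> ?\<gamma>"
    proof (rule ccontr)
      assume "\<not> ker_of A p \<subseteq> ?\<gamma>"
      then obtain x y where x: "x \<in> carrier A" and y: "y \<in> carrier A" and "p x = p y"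
        and sep: "(x, y) \<notin> ?\<gamma>"
        by (auto simp: ker_of_def)
      obtain g where g: "is_hom ar A (alg E) g" and "g x \<noteq> g y"
        by (rule regular_separates[OF assms(1,2,4) u RD2 x y sep])
      let ?inv = "inv_into (carrier A) \<psi>"
      have hom: "is_hom ar ?P (alg E) (g \<circ> ?inv)"
        by (rule is_hom_compose[OF is_iso_inverse[OF A \<psi>] g])
      have uA: "u \<in> carrier A" and u_oper: "\<And>f. oper A f (replicate (ar f) u) = u"
        using u by (auto simp: idempotent_element_def)
      have "oper ?P f (replicate (ar f) (\<psi> u)) = \<psi> u" for f
      proof -
        have "replicate (ar f) u \<in> args (carrier A) (ar f)"
          using uA by (auto simp: args_def)
        from is_homD(2)[OF hom_\<psi> this] show ?thesis
          using u_oper by simp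
      qed
      then have "idempotent_element ar ?P (\<psi> u)"
        using uA is_homD(1)[OF hom_\<psi>] by (simp add: idempotent_element_def)
      then have idem: "idempotent_element ar ?P (fst (\<psi> u), snd (\<psi> u))"
        by simp
      note Q_mal = satisfies_mal[OF identities_satisfied[OF assms(1) Q mal]]
        and T_mal = compatible_mal[OF B T arity comp mal]
      obtain \<theta> where \<theta>: "\<theta> \<in> carrier (Hom ar B E)"
        and coh: "cohomologous ar Q E (push \<theta>) (push (\<lambda>x\<in>carrier B. \<zero>\<^bsub>E\<^esub>))"
        and eq: "\<And>b q. b \<in> carrier B \<Longrightarrow> q \<in> carrier Q \<Longrightarrow>
          (g \<circ> ?inv) (b, q) = \<theta> b \<oplus>\<^bsub>E\<^esub> (g \<circ> ?inv) (\<zero>\<^bsub>B\<^esub>, q)"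
        by (rule hom_imp_cohomologous[OF hom idem]) (rule Q_mal T_mal that; assumption)+
      \<comment> \<open>The pushforward along \<open>\<theta>\<close> has the class of the one along
        the zero map, so injectivity forces \<open>\<theta>\<close> to vanish.\<close>
      have "transgression ar \<U> Q E T \<theta> = transgression ar \<U> Q E T (\<lambda>x\<in>carrier B. \<zero>\<^bsub>E\<^esub>)"
        using coh by (simp only: transgression_eq_iff[OF \<theta> const_zero_in_Hom])
      then have \<theta>_zero: "\<theta> = (\<lambda>x\<in>carrier B. \<zero>\<^bsub>E\<^esub>)"
        by (rule inj_onD[OF inj _ \<theta> const_zero_in_Hom])
      \<comment> \<open>With \<open>\<theta>\<close> zero, \<open>g\<close> no longer depends on the
        first coordinate, although it separates \<open>x\<close> and \<open>y\<close>, which lie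
        over one point of \<open>Q\<close>.\<close>
      have fibre: "(g \<circ> ?inv) (b, q) = (g \<circ> ?inv) (b', q)"
        if "b \<in> carrier B" "b' \<in> carrier B" "q \<in> carrier Q" for b b' q
      proof -
        have "\<theta> b = \<theta> b'"
          using \<theta>_zero that by simp
        then show ?thesis
          by (simp only: eq[OF that(1,3)] eq[OF that(2,3)])
      qed
      obtain b q b' where \<psi>_xy: "\<psi> x = (b, q)" "\<psi> y = (b', q)"
        using p[OF x] p[OF y] \<open>p x = p y\<close> by (metis prod.collapse)
      then have "b \<in> carrier B" "b' \<in> carrier B" "q \<in> carrier Q"
        using is_homD(1)[OF hom_\<psi> x] is_homD(1)[OF hom_\<psi> y] by (simp_all add: tensor_alg_def)
      then have "(g \<circ> ?inv) (\<psi> x) = (g \<circ> ?inv) (\<psi> y)"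
        unfolding \<psi>_xy by (rule fibre)
      moreover have "?inv (\<psi> x) = x" "?inv (\<psi> y) = y"
        using bij x y by (simp_all add: bij_betw_def)
      ultimately show False
        using \<open>g x \<noteq> g y\<close> by simp
    qed
  qed
qed

end
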